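(* Let $C\subseteq\mathbb R^d$ be a $p$-convex set ($p\in\mathbb N$) with $|C|=1$, let $\mathbf c_n=(c_{n,1},\dots,c_{n,d})$ be vectors with $0<c_{n,\ell}\to\infty$ for each $\ell$, and let $D_n=(\mathbf c_nC)\cap\mathbb Z^d$. Let $(\xi_v)_{v\in\mathbb Z^d}$ be a stationary real-valued random field satisfying condition $\mathcal D(x_n;K_n)$ for some real sequence $(x_n)_{n\in\mathbb N}$, with associated vectors $\boldsymbol\gamma_n$ and constants $\alpha_n$. Let $(k_n)$ be a sequence of integers satisfying $k_n\to\infty$, $k_n\alpha_n\to0$ and $k_n^{1/d}\boldsymbol\gamma_n=o(\mathbf c_n)$ as $n\to\infty$, such that condition $\mathcal D^\ell(x_n;k_n;\theta)$ is satisfied for some $\theta\in(0,1]$. If, for some $0<\tau<\infty$, $|D_n|\,\mathbb P(\xi_0>x_n)\to\tau$, then $N_n\stackrel{vd}{\to}N$, where $N$ is a homogeneous Poisson measure on $C$ with intensity $\theta\tau$.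
   Context: Notation: $d\in\mathbb N$; $|\cdot|$ denotes the Euclidean norm of a point, Lebesgue measure of a full-dimensional subset of $\mathbb R^d$, and cardinality of a subset of $\mathbb Z^d$. For vectors $\mathbf r=(r_1,\dots,r_d)$ and $A\subseteq\mathbb R^d$, $\mathbf rA=\{(r_1a_1,\dots,r_da_d):a\in A\}$; products and quotients of vectors are coordinate-wise. $A\oplus B$ is the Minkowski sum, $B(1)$ the closed Euclidean unit ball. $\mathbf r_n=o(\mathbf c_n)$ means $r_{n,\ell}/c_{n,\ell}\to0$ for each $\ell$. $M_\xi(A)=\max_{v\in A}\xi_v$, with $M_\xi(\emptyset)=-\infty$. A convex body is a compact convex subset of $\mathbb R^d$ with non-empty interior; a set is $p$-convex if it is a union of $p$ convex bodies. Write $C_n=\mathbf c_nC$. Boxes: every sequence $(k_n)$ considered consists of positive integers with $k_n\to\infty$ and $k_n^{1/d}=o(c_{n,\ell})$ for all $\ell$. Put $t_{n,k_n}^\ell=\lfloor c_{n,\ell}/k_n^{1/d}\rfloor$, $\mathbf t_{n,k_n}=(t_{n,k_n}^1,\dots,t_{n,k_n}^d)$, and for $z\in\mathbb Z^d$, $I_z^{n,k_n}=\mathbf t_{n,k_n}(z+[0,1)^d)$, $J_z^{n,k_n}=I_z^{n,k_n}\cap\mathbb Z^d$, and $D_{n,k_n}^+=\bigcup\{J_z^{n,k_n}: I_z^{n,k_n}\cap C_n\ne\emptyset\}$. $K_n=\mathbb Z^d\cap\mathbf c_n[-c,c]^d$, where $0<c<\infty$ is a fixed constant (which can be chosen independently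 of $(k_n)$) such that $D_{n,k_n}^+\subseteq K_n$ for all $n$. Condition $\mathcal D(x_n;K_n)$: sets $A,B\subseteq\mathbb Z^d$ are $\boldsymbol\gamma$-separated if $B\subseteq(A\oplus\boldsymbol\gamma B(1))^c$. The condition holds for $(\xi_v)$ if there is an increasing sequence of $d$-dimensional vectors $\boldsymbol\gamma_n$ with $\boldsymbol\gamma_n=o(\mathbf c_n)$ and constants $\alpha_n\to0$ such that for all $n$ and all $\boldsymbol\gamma_n$-separated $A,B\subseteq K_n$, at least one of which is a box, $|\mathbb P(M_\xi(A\cup B)\le x_n)-\mathbb P(M_\xi(A)\le x_n)\mathbb P(M_\xi(B)\le x_n)|\le\alpha_n$. Order: $\preceq$ is an arbitrary fixed translation invariant total order on $\mathbb Z^d$, and $A_v^{n,k_n}=\{z\in(v+\mathbf t_{n,k_n}[-1,1]^d)\cap\mathbb Z^d: v\prec z\}$. Condition $\mathcal D^\ell(x_n;k_n;\theta)$: $\mathbb P(M_\xi(A_0^{n,k_n})\le x_n\mid\xi_0>x_n)\to\theta$ as $n\to\infty$. Cluster counting process: $N_n$ is the random measure on $C$ given by $N_n(A)=\sum_{z\in\mathbb Z^d}\mathbf 1_A\bigl(z\,\mathbf t_{n,k_n}/\mathbf c_n\bigr)\mathbf 1_{\{M_\xi(J_z^{n,k_n})>x_n\}}$ for Borel $A\subseteq C$. Convergence: $N_n\stackrel{vd}{\to}N$ (convergence in distribution with respect to the vague topology) means that $\int_Cf\,dN_n\to\int_Cf\,dN$ in distribution for all bounded continuous functions $f:C\to[0,\infty)$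 with compact support. *)

theory Defs
  imports "HOL-Probability.Probability" "HOL-Library.Set_Algebras"
begin

section \<open>Lattice, boxes and convex bodies\<close>

text \<open>
  Multiplication on \<^typ>\<open>real ^ 'd\<close> is the library's coordinate-wise product, so the dilation
  of a set \<open>A\<close> by a vector \<open>r\<close> is the image \<open>(*) r ` A\<close>.
\<close>

definition of_lattice :: "int ^ 'd \<Rightarrow> real ^ 'd" where
  "of_lattice v = (\<chi> i. real_of_int (v $ i))"

text \<open>The intersection of \<open>S\<close> with the integer lattice, as a subset of \<^typ>\<open>int ^ 'd\<close>.\<close>

definition lattice_points :: "(real ^ 'd) set \<Rightarrow> (int ^ 'd) set" where
  "lattice_points S = {v. of_lattice v \<in> S}"

definition vec_smallo :: "(nat \<Rightarrow> real ^ 'd) \<Rightarrow> (nat \<Rightarrow> real ^ 'd) \<Rightarrow> bool" where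
  "vec_smallo r c \<longleftrightarrow> (\<forall>i. (\<lambda>n. r n $ i / c n $ i) \<longlonglongrightarrow> 0)"

definition convex_body :: "(real ^ 'd) set \<Rightarrow> bool" where
  "convex_body B \<longleftrightarrow> compact B \<and> convex B \<and> interior B \<noteq> {}"

definition p_convex :: "nat \<Rightarrow> (real ^ 'd) set \<Rightarrow> bool" where
  "p_convex p C \<longleftrightarrow> (\<exists>B. (\<forall>i<p. convex_body (B i)) \<and> C = (\<Union>i<p. B i))"

definition box_side :: "real ^ 'd \<Rightarrow> nat \<Rightarrow> real ^ 'd" where
  "box_side c k = (\<chi> i. of_int \<lfloor>c $ i / root CARD('d) (real k)\<rfloor>)"

definition I_box :: "real ^ 'd \<Rightarrow> nat \<Rightarrow> int ^ 'd \<Rightarrow> (real ^ 'd) set" where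
  "I_box c k z = (*) (box_side c k) ` ((+) (of_lattice z) ` {x. \<forall>i. 0 \<le> x $ i \<and> x $ i < 1})"

definition J_box :: "real ^ 'd \<Rightarrow> nat \<Rightarrow> int ^ 'd \<Rightarrow> (int ^ 'd) set" where
  "J_box c k z = lattice_points (I_box c k z)"

definition D_plus :: "real ^ 'd \<Rightarrow> nat \<Rightarrow> (real ^ 'd) set \<Rightarrow> (int ^ 'd) set" where
  "D_plus c k C = \<Union> {J_box c k z | z. I_box c k z \<inter> (*) c ` C \<noteq> {}}"

definition K_set :: "real \<Rightarrow> real ^ 'd \<Rightarrow> (int ^ 'd) set" where
  "K_set \<kappa> c = lattice_points ((*) c ` cbox (\<chi> i. - \<kappa>) (\<chi> i. \<kappa>))"

section \<open>Random fields\<close>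

text \<open>
  The supremum in the extended reals is the maximum for finite non-empty \<open>A\<close>, and \<open>-\<infinity>\<close> for the
  empty set.
\<close>

definition field_max :: "(int ^ 'd \<Rightarrow> 'a \<Rightarrow> real) \<Rightarrow> (int ^ 'd) set \<Rightarrow> 'a \<Rightarrow> ereal" where
  "field_max \<xi> A \<omega> = (SUP v\<in>A. ereal (\<xi> v \<omega>))"

definition stationary_field :: "'a measure \<Rightarrow> (int ^ 'd \<Rightarrow> 'a \<Rightarrow> real) \<Rightarrow> bool" where
  "stationary_field M \<xi> \<longleftrightarrow>
     (\<forall>v. \<xi> v \<in> borel_measurable M) \<and>
     (\<forall>h. distr M (PiM UNIV (\<lambda>_. borel)) (\<lambda>\<omega> v. \<xi> (v + h) \<omega>) =
          distr M (PiM UNIV (\<lambda>_. borel)) (\<lambda>\<omega> v. \<xi> v \<omega>))"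

definition separated :: "real ^ 'd \<Rightarrow> (int ^ 'd) set \<Rightarrow> (int ^ 'd) set \<Rightarrow> bool" where
  "separated \<gamma> A B \<longleftrightarrow> of_lattice ` B \<subseteq> - (of_lattice ` A + (*) \<gamma> ` cball 0 1)"

text \<open>The order on \<^typ>\<open>int ^ 'd\<close> is coordinate-wise, so the intervals below are the discrete boxes.\<close>

definition is_box :: "(int ^ 'd) set \<Rightarrow> bool" where
  "is_box A \<longleftrightarrow> (\<exists>a b. A = {a..b})"

text \<open>
  The separation vectors \<open>\<gamma>\<close> and the constants \<open>\<alpha>\<close> are explicit parameters, since further
  assumptions are imposed on them.
\<close>

definition condition_D ::
  "'a measure \<Rightarrow> (int ^ 'd \<Rightarrow> 'a \<Rightarrow> real) \<Rightarrow> (nat \<Rightarrow> real) \<Rightarrow> (nat \<Rightarrow> (int ^ 'd) set) \<Rightarrow>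
   (nat \<Rightarrow> real ^ 'd) \<Rightarrow> (nat \<Rightarrow> real ^ 'd) \<Rightarrow> (nat \<Rightarrow> real) \<Rightarrow> bool" where
  "condition_D M \<xi> x K c \<gamma> \<alpha> \<longleftrightarrow>
     incseq \<gamma> \<and> vec_smallo \<gamma> c \<and> \<alpha> \<longlonglongrightarrow> 0 \<and>
     (\<forall>n A B. A \<subseteq> K n \<and> B \<subseteq> K n \<and> separated (\<gamma> n) A B \<and> (is_box A \<or> is_box B) \<longrightarrow>
        \<bar>\<P>(\<omega> in M. field_max \<xi> (A \<union> B) \<omega> \<le> x n)
          - \<P>(\<omega> in M. field_max \<xi> A \<omega> \<le> x n) * \<P>(\<omega> in M. field_max \<xi> B \<omega> \<le> x n)\<bar> \<le> \<alpha> n)"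

definition translation_invariant_order :: "(int ^ 'd) rel \<Rightarrow> bool" where
  "translation_invariant_order r \<longleftrightarrow>
     linear_order r \<and> (\<forall>u v w. (u, v) \<in> r \<longrightarrow> (u + w, v + w) \<in> r)"

definition A_set :: "(int ^ 'd) rel \<Rightarrow> real ^ 'd \<Rightarrow> nat \<Rightarrow> int ^ 'd \<Rightarrow> (int ^ 'd) set" where
  "A_set r c k v =
     {z \<in> lattice_points ((+) (of_lattice v) ` ((*) (box_side c k) ` cbox (-1) 1)).
        (v, z) \<in> r \<and> v \<noteq> z}"

definition condition_Dl ::
  "'a measure \<Rightarrow> (int ^ 'd \<Rightarrow> 'a \<Rightarrow> real) \<Rightarrow> (int ^ 'd) rel \<Rightarrow> (nat \<Rightarrow> real ^ 'd) \<Rightarrow>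
   (nat \<Rightarrow> real) \<Rightarrow> (nat \<Rightarrow> nat) \<Rightarrow> real \<Rightarrow> bool" where
  "condition_Dl M \<xi> r c x k \<theta> \<longleftrightarrow>
     (\<lambda>n. \<P>(\<omega> in M. field_max \<xi> (A_set r (c n) (k n) 0) \<omega> \<le> x n \<bar> \<xi> 0 \<omega> > x n)) \<longlonglongrightarrow> \<theta>"

section \<open>Random measures\<close>

text \<open>
  A random measure on \<open>C\<close> is represented by a function from the sample space to Borel measures
  on \<open>C\<close>.
\<close>

definition cluster_process ::
  "(int ^ 'd \<Rightarrow> 'a \<Rightarrow> real) \<Rightarrow> real \<Rightarrow> real ^ 'd \<Rightarrow> nat \<Rightarrow> (real ^ 'd) set \<Rightarrow> 'a \<Rightarrow>
   (real ^ 'd) measure" where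
  "cluster_process \<xi> x c k C \<omega> =
     measure_of C (sets (restrict_space borel C))
       (\<lambda>A. \<integral>\<^sup>+ z. indicator A (\<chi> i. real_of_int (z $ i) * box_side c k $ i / c $ i) *
                  of_bool (field_max \<xi> (J_box c k z) \<omega> > x) \<partial>count_space UNIV)"

text \<open>The set function given above is a measure, so it is the one defined by \<^const>\<open>measure_of\<close>.\<close>

lemma emeasure_cluster_process:
  assumes "A \<in> sets (restrict_space borel C)"
  shows "emeasure (cluster_process \<xi> x c k C \<omega>) A =
    (\<integral>\<^sup>+ z. indicator A (\<chi> i. real_of_int (z $ i) * box_side c k $ i / c $ i) *
           of_bool (field_max \<xi> (J_box c k z) \<omega> > x) \<partial>count_space UNIV)"
    (is "_ = ?\<mu> A")
proof (rule emeasure_measure_of[OF cluster_process_def])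
  show "sets (restrict_space borel C) \<subseteq> Pow C"
    using sets.sets_into_space[of _ "restrict_space borel C"]
    by (auto simp: space_restrict_space)
  have "sets (cluster_process \<xi> x c k C \<omega>) = sets (restrict_space borel C)"
    unfolding cluster_process_def
    using sets.sigma_sets_eq[of "restrict_space borel C"] sets.space_closed[of "restrict_space borel C"]
    by (simp add: space_restrict_space)
  then show "A \<in> sets (cluster_process \<xi> x c k C \<omega>)"
    and "countably_additive (sets (cluster_process \<xi> x c k C \<omega>)) ?\<mu>"
    using assms
    by (auto simp: countably_additive_def nn_integral_suminf[symmetric] suminf_indicator[symmetric]
        mult_ac simp flip: ennreal_suminf_cmult)
  show "positive (sets (cluster_process \<xi> x c k C \<omega>)) ?\<mu>"
    by (simp add: positive_def)
qed

definition random_measure ::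
  "'b measure \<Rightarrow> (real ^ 'd) set \<Rightarrow> ('b \<Rightarrow> (real ^ 'd) measure) \<Rightarrow> bool" where
  "random_measure P C N \<longleftrightarrow>
     (\<forall>\<omega>\<in>space P. sets (N \<omega>) = sets (restrict_space borel C)) \<and>
     (\<forall>A\<in>sets (restrict_space borel C). (\<lambda>\<omega>. emeasure (N \<omega>) A) \<in> borel_measurable P)"

definition homogeneous_poisson_measure ::
  "'b measure \<Rightarrow> (real ^ 'd) set \<Rightarrow> real \<Rightarrow> ('b \<Rightarrow> (real ^ 'd) measure) \<Rightarrow> bool" where
  "homogeneous_poisson_measure P C l N \<longleftrightarrow>
     random_measure P C N \<and>
     (\<forall>A\<in>sets (restrict_space borel C). emeasure lborel A < \<infinity> \<longrightarrow>
        (\<forall>j::nat. \<P>(\<omega> in P. emeasure (N \<omega>) A = of_nat j) =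
                  (l * measure lborel A) ^ j / fact j * exp (- (l * measure lborel A)))) \<and>
     (\<forall>(m::nat) A. (\<forall>i<m. A i \<in> sets (restrict_space borel C)) \<and> disjoint_family_on A {..<m} \<longrightarrow>
        prob_space.indep_vars P (\<lambda>_. borel) (\<lambda>i \<omega>. emeasure (N \<omega>) (A i)) {..<m})"

text \<open>
  Convergence in distribution for the vague topology. The random measures \<open>Ns n\<close> live on the
  probability space \<open>M\<close> and the limit \<open>N\<close> on \<open>P\<close>; the set whose compactness is required is the
  support of \<open>f\<close> relative to \<open>C\<close>.
\<close>

definition vd_converges ::
  "(real ^ 'd) set \<Rightarrow> 'a measure \<Rightarrow> (nat \<Rightarrow> 'a \<Rightarrow> (real ^ 'd) measure) \<Rightarrow>
   'b measure \<Rightarrow> ('b \<Rightarrow> (real ^ 'd) measure) \<Rightarrow> bool" where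
  "vd_converges C M Ns P N \<longleftrightarrow>
     (\<forall>f :: real ^ 'd \<Rightarrow> real.
        continuous_on C f \<and> bounded (f ` C) \<and> (\<forall>y\<in>C. 0 \<le> f y) \<and>
        compact (C \<inter> closure {y \<in> C. f y \<noteq> 0}) \<longrightarrow>
        weak_conv_m (\<lambda>n. distr M borel (\<lambda>\<omega>. \<integral>y. f y \<partial>(Ns n \<omega>)))
                    (distr P borel (\<lambda>\<omega>. \<integral>y. f y \<partial>(N \<omega>))))"

end

theory Submission
  imports Defs
begin

text \<open>
  By the Weierstrass theorem, convergence in distribution of \<open>\<integral> f dN\<^sub>n\<close> follows from convergence of
  its Laplace transform at the integers, so only the Laplace functional of \<open>N\<^sub>n\<close> has to be identified.
  Trimming each box by the mixing range makes the boxes separated at negligible cost, and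
  condition \<open>\<D>\<close> then factorises the probability of avoiding exceedances in any family of boxes up to
  an error of order \<open>k\<^sub>n \<alpha>\<^sub>n\<close>. Since \<open>1 - exp (- f)\<close> takes values in \<open>[0, 1)\<close>, the Laplace functional is an
  average of such avoidance probabilities over a random subfamily of boxes, hence it is asymptotic to
  \<open>\<Prod>\<^sub>z (1 - (1 - exp (- f (y\<^sub>z))) p\<^sub>n)\<close>, with \<open>p\<^sub>n\<close> the probability of an exceedance in one box and \<open>y\<^sub>z\<close> the
  atom attached to the box with index \<open>z\<close>. Counting each box with an
  exceedance by its last exceedance gives \<open>k\<^sub>n p\<^sub>n \<longlonglongrightarrow> \<theta> \<tau>\<close>, and the exponent is a Riemann sum that
  converges to \<open>\<theta> \<tau> \<integral>\<^sub>C (1 - exp (- f))\<close>, as for the Poisson measure.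
\<close>

section \<open>Laplace transforms and weak convergence\<close>

text \<open>Condition D decouples only two sets at a time, one of them a box, and each use costs
  \<open>\<alpha> n\<close>. About \<open>k n\<close> boxes have to be peeled off in turn, hence the
  requirement that k alpha tends to 0. It speaks of avoidance probabilities alone, which is why the
  Laplace functional is written as a mixture of them. Trimming is cheap because k^(1/d) gamma = o(c)
  makes the removed shell a vanishing fraction of its box, while all boxes together carry a bounded
  expected number of exceedances. The delicate point is the limit theta tau. The neighbourhood in
  condition D^l extends by a full box side in every direction, so around a site of a box it sticks
  out of the box. The last exceedance in a box may then be followed by another one outside and go
  uncounted. This needs exceedances both in the box and in the rest of the surrounding block of 3^d
  boxes. A second use of condition D bounds its probability by a term of order k^(-2), the mixing
  error and the shell cost, each o(1/k).\<close>

lemma tendsto_expectation_polynomial_laplace: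
  fixes X :: "nat \<Rightarrow> 'a \<Rightarrow> real" and Y :: "'b \<Rightarrow> real"
  assumes "prob_space M" and "prob_space P"
    and [measurable]: "\<And>n. X n \<in> borel_measurable M" "Y \<in> borel_measurable P"
    and nonneg: "\<And>n \<omega>. \<omega> \<in> space M \<Longrightarrow> 0 \<le> X n \<omega>" "\<And>\<omega>. \<omega> \<in> space P \<Longrightarrow> 0 \<le> Y \<omega>"
    and lim: "\<And>m::nat. (\<lambda>n. \<integral>\<omega>. exp (- (real m * X n \<omega>)) \<partial>M) \<longlonglongrightarrow> (\<integral>\<omega>. exp (- (real m * Y \<omega>)) \<partial>P)"
    and "real_polynomial_function g"
  shows "(\<lambda>n. \<integral>\<omega>. g (exp (- X n \<omega>)) \<partial>M) \<longlonglongrightarrow> (\<integral>\<omega>. g (exp (- Y \<omega>)) \<partial>P)"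
proof -
  interpret M: prob_space M by fact
  interpret P: prob_space P by fact
  obtain a m where g: "g = (\<lambda>x. \<Sum>i\<le>(m::nat). a i * x ^ i)"
    using assms(8) unfolding real_polynomial_function_iff_sum by blast
  have intX: "integrable M (\<lambda>\<omega>. exp (- (real i * X n \<omega>)))" for i n
    by (rule M.integrable_const_bound[of _ 1]) (auto simp: nonneg)
  have intY: "integrable P (\<lambda>\<omega>. exp (- (real i * Y \<omega>)))" for i
    by (rule P.integrable_const_bound[of _ 1]) (auto simp: nonneg)
  have "(\<integral>\<omega>. g (exp (- X n \<omega>)) \<partial>M) = (\<Sum>i\<le>m. a i * (\<integral>\<omega>. exp (- (real i * X n \<omega>)) \<partial>M))" for n
    unfolding g using intX by (simp flip: exp_of_nat_mult)
  moreover have "(\<integral>\<omega>. g (exp (- Y \<omega>)) \<partial>P) = (\<Sum>i\<le>m. a i * (\<integral>\<omega>. exp (- (real i * Y \<omega>)) \<partial>P))"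
    unfolding g using intY by (simp flip: exp_of_nat_mult)
  ultimately show ?thesis
    by (auto intro!: tendsto_intros lim)
qed

text \<open>Nonnegativity places \<open>exp (- X n \<omega>)\<close> in [0, 1], where a polynomial
  approximates \<open>h\<close> within e/3. The replacement costs at most e/3 on either side,
  uniformly in n, and the polynomial case accounts for the remaining third.\<close>

lemma tendsto_expectation_continuous_laplace:
  fixes X :: "nat \<Rightarrow> 'a \<Rightarrow> real" and Y :: "'b \<Rightarrow> real"
  assumes M: "prob_space M" and P: "prob_space P"
    and meas [measurable]: "\<And>n. X n \<in> borel_measurable M" "Y \<in> borel_measurable P"
    and nonneg: "\<And>n \<omega>. \<omega> \<in> space M \<Longrightarrow> 0 \<le> X n \<omega>" "\<And>\<omega>. \<omega> \<in> space P \<Longrightarrow> 0 \<le> Y \<omega>"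
    and lim: "\<And>m::nat. (\<lambda>n. \<integral>\<omega>. exp (- (real m * X n \<omega>)) \<partial>M) \<longlonglongrightarrow> (\<integral>\<omega>. exp (- (real m * Y \<omega>)) \<partial>P)"
    and cont: "continuous_on {0..1} (h :: real \<Rightarrow> real)" and [measurable]: "h \<in> borel_measurable borel"
  shows "(\<lambda>n. \<integral>\<omega>. h (exp (- X n \<omega>)) \<partial>M) \<longlonglongrightarrow> (\<integral>\<omega>. h (exp (- Y \<omega>)) \<partial>P)"
proof (rule LIMSEQ_I)
  fix e :: real assume "0 < e"
  then have "0 < e / 3" by simp
  interpret M: prob_space M by fact
  interpret P: prob_space P by fact
  obtain g where g: "real_polynomial_function g" and near: "\<And>y. y \<in> {0..1} \<Longrightarrow> \<bar>h y - g y\<bar> < e / 3"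
    using Stone_Weierstrass_real_polynomial_function[OF compact_Icc cont \<open>0 < e / 3\<close>] by blast
  have g_cont: "continuous_on UNIV g"
    using g by (simp add: real_polynomial_function_eq continuous_on_polymonial_function)
  then have [measurable]: "g \<in> borel_measurable borel"
    by (rule borel_measurable_continuous_onI)
  obtain B where B: "\<And>y. y \<in> {0..1} \<Longrightarrow> \<bar>h y\<bar> \<le> B"
    using compact_imp_bounded[OF compact_continuous_image[OF cont compact_Icc]]
    unfolding bounded_iff by (metis imageI real_norm_def)
  obtain B' where B': "\<And>y. y \<in> {0..1} \<Longrightarrow> \<bar>g y\<bar> \<le> B'"
    using compact_imp_bounded[OF compact_continuous_image[OF continuous_on_subset[OF g_cont subset_UNIV] compact_Icc[of 0 1]]]
    unfolding bounded_iff by (metis imageI real_norm_def)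
  have in01X: "exp (- X n \<omega>) \<in> {0..1}" if "\<omega> \<in> space M" for n \<omega> using nonneg(1)[OF that] by simp
  have in01Y: "exp (- Y \<omega>) \<in> {0..1}" if "\<omega> \<in> space P" for \<omega> using nonneg(2)[OF that] by simp
  have ihX: "integrable M (\<lambda>\<omega>. h (exp (- X n \<omega>)))" for n
    by (rule M.integrable_const_bound[of _ B]) (use B[OF in01X] in auto)
  have igX: "integrable M (\<lambda>\<omega>. g (exp (- X n \<omega>)))" for n
    by (rule M.integrable_const_bound[of _ B']) (use B'[OF in01X] in auto)
  have ihY: "integrable P (\<lambda>\<omega>. h (exp (- Y \<omega>)))"
    by (rule P.integrable_const_bound[of _ B]) (use B[OF in01Y] in auto)
  have igY: "integrable P (\<lambda>\<omega>. g (exp (- Y \<omega>)))"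
    by (rule P.integrable_const_bound[of _ B']) (use B'[OF in01Y] in auto)
  have dX: "\<bar>(\<integral>\<omega>. h (exp (- X n \<omega>)) \<partial>M) - (\<integral>\<omega>. g (exp (- X n \<omega>)) \<partial>M)\<bar> \<le> e / 3" for n
  proof -
    have "\<bar>(\<integral>\<omega>. h (exp (- X n \<omega>)) - g (exp (- X n \<omega>)) \<partial>M)\<bar> \<le> (\<integral>\<omega>. e / 3 \<partial>M)"
      using ihX igX near[OF in01X] by (intro integral_abs_bound[THEN order_trans] integral_mono) (auto intro: less_imp_le)
    then show ?thesis using ihX igX by (simp add: M.prob_space)
  qed
  have dY: "\<bar>(\<integral>\<omega>. h (exp (- Y \<omega>)) \<partial>P) - (\<integral>\<omega>. g (exp (- Y \<omega>)) \<partial>P)\<bar> \<le> e / 3"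
  proof -
    have "\<bar>(\<integral>\<omega>. h (exp (- Y \<omega>)) - g (exp (- Y \<omega>)) \<partial>P)\<bar> \<le> (\<integral>\<omega>. e / 3 \<partial>P)"
      using ihY igY near[OF in01Y] by (intro integral_abs_bound[THEN order_trans] integral_mono) (auto intro: less_imp_le)
    then show ?thesis using ihY igY by (simp add: P.prob_space)
  qed
  obtain N where "\<And>n. n \<ge> N \<Longrightarrow> \<bar>(\<integral>\<omega>. g (exp (- X n \<omega>)) \<partial>M) - (\<integral>\<omega>. g (exp (- Y \<omega>)) \<partial>P)\<bar> < e / 3"
    using LIMSEQ_D[OF tendsto_expectation_polynomial_laplace[OF M P meas nonneg lim g] \<open>0 < e / 3\<close>] by auto
  then have N: "\<bar>(\<integral>\<omega>. g (exp (- X n \<omega>)) \<partial>M) - (\<integral>\<omega>. g (exp (- Y \<omega>)) \<partial>P)\<bar> < e / 3" if "n \<ge> N" for n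
    using that .
  have "norm ((\<integral>\<omega>. h (exp (- X n \<omega>)) \<partial>M) - (\<integral>\<omega>. h (exp (- Y \<omega>)) \<partial>P)) < e" if "n \<ge> N" for n
    using dX[of n] dY N[OF that] unfolding real_norm_def by arith
  then show "\<exists>no. \<forall>n\<ge>no. norm ((\<integral>\<omega>. h (exp (- X n \<omega>)) \<partial>M) - (\<integral>\<omega>. h (exp (- Y \<omega>)) \<partial>P)) < e"
    by blast
qed

text \<open>
  Substituting \<open>y = exp (- x)\<close> turns the Laplace transforms at the integers into moments of random
  variables in \<open>[0, 1]\<close>, which determine the limit by the Weierstrass theorem.
\<close>

lemma weak_conv_laplace:
  fixes X :: "nat \<Rightarrow> 'a \<Rightarrow> real" and Y :: "'b \<Rightarrow> real"
  assumes M: "prob_space M" and P: "prob_space P"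
    and meas [measurable]: "\<And>n. X n \<in> borel_measurable M" "Y \<in> borel_measurable P"
    and nonneg: "\<And>n \<omega>. \<omega> \<in> space M \<Longrightarrow> 0 \<le> X n \<omega>" "\<And>\<omega>. \<omega> \<in> space P \<Longrightarrow> 0 \<le> Y \<omega>"
    and lim: "\<And>m::nat. (\<lambda>n. \<integral>\<omega>. exp (- (real m * X n \<omega>)) \<partial>M) \<longlonglongrightarrow> (\<integral>\<omega>. exp (- (real m * Y \<omega>)) \<partial>P)"
  shows "weak_conv_m (\<lambda>n. distr M borel (X n)) (distr P borel Y)"
proof (rule integral_cts_step_conv_imp_weak_conv)
  interpret M: prob_space M by fact
  interpret P: prob_space P by fact
  show "real_distribution (distr M borel (X n))" for n
    by (rule M.real_distribution_distr) simp
  show "real_distribution (distr P borel Y)"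
    by (rule P.real_distribution_distr) simp
  fix a b :: real assume "a < b"
  \<comment> \<open>The maximum with \<open>exp (- b)\<close> keeps \<open>ln\<close> away from its
    singularity at 0. It changes nothing on the relevant values, as \<open>cts_step a b\<close> is
    constantly 0 from \<open>b\<close> on.\<close>
  define h where "h y = cts_step a b (- ln (max (exp (- b)) y))" for y
  have cts: "continuous_on UNIV (cts_step a b)"
    using cts_step_uniformly_continuous[OF \<open>a < b\<close>] by (rule uniformly_continuous_imp_continuous)
  have "continuous_on S h" for S
    unfolding h_def
    by (rule continuous_on_compose2[OF cts], intro continuous_intros) (auto simp: max_def not_le intro: less_trans[OF exp_gt_zero])
  then have h_cont: "continuous_on {0..1} h" and [measurable]: "h \<in> borel_measurable borel"
    by (auto intro: borel_measurable_continuous_onI)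
  have h: "h (exp (- y)) = cts_step a b y" for y
    using \<open>a < b\<close> by (auto simp: h_def max_def cts_step_def)
  have [measurable]: "cts_step a b \<in> borel_measurable borel"
    by (rule borel_measurable_continuous_onI) (rule cts)
  show "(\<lambda>n. integral\<^sup>L (distr M borel (X n)) (cts_step a b)) \<longlonglongrightarrow> integral\<^sup>L (distr P borel Y) (cts_step a b)"
    using tendsto_expectation_continuous_laplace[OF M P meas nonneg lim h_cont]
    by (simp add: h integral_distr)
qed

section \<open>Riemann sums over scaled lattices\<close>

lemma bij_betw_vec_lambda_PiE:
  "bij_betw vec_lambda (PiE UNIV S) {v :: 'a ^ 'd. \<forall>i. v $ i \<in> S i}"
proof (rule bij_betwI[where g = "\<lambda>v i. v $ i"])
  show "vec_lambda \<in> PiE UNIV S \<rightarrow> {v :: 'a ^ 'd. \<forall>i. v $ i \<in> S i}" by auto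
qed (auto simp: vec_eq_iff)

lemma
  fixes S :: "'d::finite \<Rightarrow> 'a set"
  shows card_vec_Pi: "card {v :: 'a ^ 'd. \<forall>i. v $ i \<in> S i} = (\<Prod>i\<in>UNIV. card (S i))"
    and finite_vec_Pi: "(\<And>i. finite (S i)) \<Longrightarrow> finite {v :: 'a ^ 'd. \<forall>i. v $ i \<in> S i}"
  using bij_betw_same_card[OF bij_betw_vec_lambda_PiE[of S]] bij_betw_finite[OF bij_betw_vec_lambda_PiE[of S]]
  by (auto simp: card_PiE intro!: finite_PiE)

text \<open>The cells are half-open so that they partition the space and every point has exactly one
  \<open>cell_index\<close>.\<close>

definition lattice_cell :: "real ^ 'd \<Rightarrow> int ^ 'd \<Rightarrow> (real ^ 'd) set" where
  "lattice_cell s z = {y. \<forall>i. s $ i * of_int (z $ i) \<le> y $ i \<and> y $ i < s $ i * (of_int (z $ i) + 1)}"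

definition cell_index :: "real ^ 'd \<Rightarrow> real ^ 'd \<Rightarrow> int ^ 'd" where
  "cell_index s y = (\<chi> i. \<lfloor>y $ i / s $ i\<rfloor>)"

lemma in_lattice_cell_iff:
  assumes "\<And>i. 0 < s $ i"
  shows "y \<in> lattice_cell s z \<longleftrightarrow> cell_index s y = z"
  using assms by (simp add: lattice_cell_def cell_index_def vec_eq_iff floor_eq_iff field_simps)

lemma sets_lattice_cell [measurable]: "lattice_cell s z \<in> sets borel"
proof -
  have "lattice_cell s z = (\<Inter>i. {y. s $ i * of_int (z $ i) \<le> y $ i} \<inter> {y. y $ i < s $ i * (of_int (z $ i) + 1)})"
    by (auto simp: lattice_cell_def)
  also have "\<dots> \<in> sets borel"
    by (intro sets.countable_INT'' sets.Int borel_closed borel_open closed_Collect_le open_Collect_less continuous_intros) auto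
  finally show ?thesis .
qed

lemma prod_Basis_cart: "(\<Prod>b\<in>(Basis :: (real ^ 'd) set). v \<bullet> b) = (\<Prod>i\<in>UNIV. v $ i)"
proof -
  have Basis: "Basis = range (\<lambda>i. axis i 1 :: real ^ 'd)"
    by (auto simp: Basis_vec_def)
  have "inj (\<lambda>i. axis i 1 :: real ^ 'd)"
    by (auto simp: inj_def axis_eq_axis)
  then show ?thesis
    unfolding Basis by (simp add: prod.reindex inner_axis)
qed

text \<open>The half-open cell lies between an open and a closed box of the same volume.\<close>

lemma emeasure_lattice_cell:
  fixes s :: "real ^ 'd"
  assumes "\<And>i. 0 < s $ i"
  shows "emeasure lborel (lattice_cell s z) = ennreal (\<Prod>i\<in>UNIV. s $ i)"
proof -
  define a where "a = (\<chi> i. s $ i * of_int (z $ i))"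
  have le: "a \<bullet> b \<le> (a + s) \<bullet> b" if "b \<in> Basis" for b
    using that assms by (auto simp: Basis_vec_def inner_axis intro: less_imp_le)
  have "box a (a + s) \<subseteq> lattice_cell s z" "lattice_cell s z \<subseteq> cbox a (a + s)"
    by (auto simp: a_def lattice_cell_def mem_box_cart distrib_left add.commute intro: less_imp_le) (metis less_imp_le)
  then have "emeasure lborel (box a (a + s)) \<le> emeasure lborel (lattice_cell s z)"
    "emeasure lborel (lattice_cell s z) \<le> emeasure lborel (cbox a (a + s))"
    by (auto intro!: emeasure_mono)
  then show ?thesis
    using le by (simp add: emeasure_lborel_box_eq emeasure_lborel_cbox_eq prod_Basis_cart)
qed

lemma finite_scaled_lattice_points:
  fixes s :: "real ^ 'd"
  assumes "\<And>i. 0 < s $ i" and "bounded C"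
  shows "finite {z. of_lattice z * s \<in> C}"
proof -
  obtain R where R: "\<And>y. y \<in> C \<Longrightarrow> norm y \<le> R"
    using \<open>bounded C\<close> by (auto simp: bounded_iff)
  have "{z. of_lattice z * s \<in> C} \<subseteq> {z. \<forall>i. z $ i \<in> {- \<lceil>R / s $ i\<rceil>..\<lceil>R / s $ i\<rceil>}}"
  proof clarify
    fix z :: "int ^ 'd" and i assume "of_lattice z * s \<in> C"
    then have "\<bar>(of_lattice z * s) $ i\<bar> \<le> R"
      using R component_le_norm_cart order_trans by blast
    then have "\<bar>real_of_int (z $ i)\<bar> \<le> R / s $ i"
      using assms(1)[of i] by (simp add: of_lattice_def abs_mult field_simps)
    also have "\<dots> \<le> of_int \<lceil>R / s $ i\<rceil>" by simp
    finally show "z $ i \<in> {- \<lceil>R / s $ i\<rceil>..\<lceil>R / s $ i\<rceil>}"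
      by (simp flip: of_int_abs add: abs_le_iff)
  qed
  then show ?thesis
    by (rule finite_subset) (rule finite_vec_Pi, simp)
qed

lemma dist_cell_index_component:
  assumes "\<And>i. 0 < s $ i"
  shows "\<bar>(of_lattice (cell_index s y) * s) $ i - y $ i\<bar> \<le> s $ i"
proof -
  have "y \<in> lattice_cell s (cell_index s y)"
    by (simp add: in_lattice_cell_iff assms)
  then have "s $ i * of_int (cell_index s y $ i) \<le> y $ i" "y $ i < s $ i * (of_int (cell_index s y $ i) + 1)"
    unfolding lattice_cell_def by auto
  then show ?thesis
    by (simp add: of_lattice_def algebra_simps abs_le_iff)
qed

text \<open>The sum is the integral of the step function \<open>G n\<close>, which evaluates
  \<open>h\<close> at the corner of the cell containing y if this corner lies in C. The corners
  converge to y, so \<open>G n y\<close> tends to \<open>h y\<close> in the interior of C and to 0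
  outside C. The frontier, where the limit is unclear, is a null set, and dominated convergence
  applies.\<close>

lemma riemann_sum_lattice:
  fixes s :: "nat \<Rightarrow> real ^ 'd" and h :: "real ^ 'd \<Rightarrow> real"
  assumes pos: "\<And>n i. 0 < s n $ i" and "s \<longlonglongrightarrow> 0"
    and "compact C" and fr: "negligible (frontier C)" and cont: "continuous_on C h"
  shows "(\<lambda>n. (\<Sum>z | of_lattice z * s n \<in> C. h (of_lattice z * s n)) * (\<Prod>i\<in>UNIV. s n $ i))
    \<longlonglongrightarrow> (LINT y:C|lborel. h y)"
proof -
  define q where "q n y = of_lattice (cell_index (s n) y) * s n" for n y
  define G where "G n y = (if q n y \<in> C then h (q n y) else 0)" for n y
  obtain B where B: "\<And>n. norm (s n) \<le> B"
    using convergent_imp_bounded[OF \<open>s \<longlonglongrightarrow> 0\<close>] by (auto simp: bounded_iff)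
  obtain R where R: "\<And>y. y \<in> C \<Longrightarrow> norm y \<le> R"
    using compact_imp_bounded[OF \<open>compact C\<close>] by (auto simp: bounded_iff)
  obtain H where "0 < H" and H: "\<And>y. y \<in> C \<Longrightarrow> \<bar>h y\<bar> \<le> H"
    using compact_imp_bounded[OF compact_continuous_image[OF cont \<open>compact C\<close>]]
    unfolding bounded_pos by (metis imageI real_norm_def)
  have fin: "finite {z. of_lattice z * s n \<in> C}" for n
    using finite_scaled_lattice_points[OF pos compact_imp_bounded[OF \<open>compact C\<close>]] .
  have closed: "closed C" using \<open>compact C\<close> by (rule compact_imp_closed)
  have G_sum: "G n y = (\<Sum>z | of_lattice z * s n \<in> C. h (of_lattice z * s n) * indicator (lattice_cell (s n) z) y)" for n y
    using fin[of n] by (simp add: in_lattice_cell_iff pos indicator_def G_def q_def sum.If_cases if_distrib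
        cong: if_cong)
  have G_meas [measurable]: "G n \<in> borel_measurable borel" for n
    unfolding G_sum by measurable
  have int_cell: "integrable lborel (indicator (lattice_cell (s n) z) :: _ \<Rightarrow> real)" for n z
    using emeasure_lattice_cell[of "s n" z] pos by (simp add: integrable_indicator_iff)
  have int_G: "(\<integral>y. G n y \<partial>lborel) = (\<Sum>z | of_lattice z * s n \<in> C. h (of_lattice z * s n)) * (\<Prod>i\<in>UNIV. s n $ i)" for n
    using int_cell emeasure_lattice_cell[of "s n"] pos
    by (simp add: G_sum measure_def sum_distrib_right prod_nonneg less_imp_le)
  have q_comp: "\<bar>q n y $ i - y $ i\<bar> \<le> s n $ i" for n y i
    unfolding q_def by (rule dist_cell_index_component) (rule pos)
  have q_lim: "(\<lambda>n. q n y) \<longlonglongrightarrow> y" for y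
  proof (rule vec_tendstoI)
    fix i
    have "(\<lambda>n. s n $ i) \<longlonglongrightarrow> 0"
      using tendsto_vec_nth[OF \<open>s \<longlonglongrightarrow> 0\<close>, of i] by simp
    then have "(\<lambda>n. q n y $ i - y $ i) \<longlonglongrightarrow> 0"
      by (rule Lim_null_comparison[rotated]) (auto simp: q_comp)
    then show "(\<lambda>n. q n y $ i) \<longlonglongrightarrow> y $ i"
      by (simp add: LIM_zero_iff)
  qed
  \<comment> \<open>If the corner lies in C, its norm is at most R, and y differs from it by at most
    B in each of the d coordinates.\<close>
  define W where "W = R + real CARD('d) * B"
  have G_bound: "\<bar>G n y\<bar> \<le> H * indicator (cball 0 W) y" for n y
  proof (cases "q n y \<in> C")
    case True
    have "norm (y - q n y) \<le> (\<Sum>i\<in>UNIV. \<bar>(y - q n y) $ i\<bar>)" by (rule norm_le_l1_cart)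
    also have "\<dots> \<le> (\<Sum>i\<in>(UNIV::'d set). B)"
      using q_comp[of n y] B[of n] component_le_norm_cart[of "s n"]
      by (intro sum_mono) (smt (verit) vector_minus_component)
    finally have "norm (y - q n y) \<le> real CARD('d) * B" by simp
    then have "norm y \<le> W"
      using R[OF True] norm_triangle_ineq[of "q n y" "y - q n y"] by (simp add: W_def)
    then show ?thesis using True H by (simp add: G_def)
  next
    case False
    then show ?thesis using \<open>0 < H\<close> by (simp add: G_def)
  qed
  have lim: "AE y in lborel. (\<lambda>n. G n y) \<longlonglongrightarrow> indicator C y *\<^sub>R h y"
  proof -
    have "AE y in lborel. y \<notin> frontier C"
      using fr by (intro AE_not_in) (auto simp: null_sets_def negligible_iff_emeasure0 frontier_def closed)
    then show ?thesis
    proof eventually_elim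
      case (elim y)
      show ?case
      proof (cases "y \<in> interior C")
        case True
        then have "eventually (\<lambda>n. q n y \<in> interior C) sequentially"
          using topological_tendstoD[OF q_lim open_interior] by blast
        then have "eventually (\<lambda>n. h (q n y) = G n y) sequentially"
          by eventually_elim (use interior_subset in \<open>auto simp: G_def\<close>)
        moreover have "(\<lambda>n. h (q n y)) \<longlonglongrightarrow> h y"
          by (rule isCont_tendsto_compose[OF continuous_on_interior[OF cont True] q_lim])
        ultimately have "(\<lambda>n. G n y) \<longlonglongrightarrow> h y"
          by (rule Lim_transform_eventually[rotated])
        moreover have "y \<in> C" using True interior_subset by blast
        ultimately show ?thesis by simp
      next
        case False
        then have "y \<in> - C"
          using elim closed by (simp add: frontier_def)
        then have "eventually (\<lambda>n. q n y \<in> - C) sequentially"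
          using topological_tendstoD[OF q_lim] closed by (metis open_Compl)
        then have "eventually (\<lambda>n. 0 = G n y) sequentially"
          by eventually_elim (auto simp: G_def)
        then have "(\<lambda>n. G n y) \<longlonglongrightarrow> 0"
          by (rule Lim_transform_eventually[OF tendsto_const])
        then show ?thesis
          using \<open>y \<in> - C\<close> by simp
      qed
    qed
  qed
  have "(\<lambda>n. \<integral>y. G n y \<partial>lborel) \<longlonglongrightarrow> (\<integral>y. indicator C y *\<^sub>R h y \<partial>lborel)"
  proof (rule integral_dominated_convergence[where w = "\<lambda>y. H * indicator (cball 0 W) y"])
    show "(\<lambda>y. indicator C y *\<^sub>R h y) \<in> borel_measurable lborel"
      using borel_measurable_continuous_on_indicator[OF _ cont] closed by simp
    show "integrable lborel (\<lambda>y. H * indicator (cball 0 W) y :: real)"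
      using emeasure_bounded_finite[OF bounded_cball, of 0 W]
      by (intro integrable_mult_right) (simp add: integrable_indicator_iff)
  qed (use lim G_bound in auto)
  then show ?thesis
    by (simp add: int_G set_lebesgue_integral_def)
qed

text \<open>Cancelling 1 + u in exp(-u) (1 + u) <= 1 <= (1 - u + u^2) (1 + u) gives |1 - u -
  exp(-u)| <= u^2. Two products of factors in [-1, 1] differ by at most the sum of the differences
  of their factors, here at most the sum of the squares, hence at most \<open>e n\<close> times the
  convergent sum.\<close>

lemma tendsto_prod_one_minus:
  fixes a :: "nat \<Rightarrow> 'i \<Rightarrow> real"
  assumes a: "\<And>n z. z \<in> Z n \<Longrightarrow> 0 \<le> a n z \<and> a n z \<le> 1 \<and> a n z \<le> e n"
    and "e \<longlonglongrightarrow> 0" and lim: "(\<lambda>n. \<Sum>z\<in>Z n. a n z) \<longlonglongrightarrow> L"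
  shows "(\<lambda>n. \<Prod>z\<in>Z n. 1 - a n z) \<longlonglongrightarrow> exp (- L)"
proof -
  have bound: "\<bar>1 - u - exp (- u)\<bar> \<le> u * u" if "0 \<le> u" "u \<le> 1" for u :: real
  proof -
    have "exp (- u) * (1 + u) \<le> exp (- u) * exp u"
      by (intro mult_left_mono) simp_all
    also have "\<dots> = 1" by (simp flip: exp_add)
    also have "1 \<le> (1 - u + u * u) * (1 + u)"
    proof -
      have "(1 - u + u * u) * (1 + u) = 1 + u * u * u" by algebra
      then show ?thesis using that by simp
    qed
    finally have "exp (- u) \<le> 1 - u + u * u"
      using that by (simp add: mult_le_cancel_right)
    then show ?thesis using exp_ge_add_one_self[of "- u"] by (simp add: abs_le_iff)
  qed
  have dev: "\<bar>(\<Prod>z\<in>Z n. 1 - a n z) - exp (- (\<Sum>z\<in>Z n. a n z))\<bar> \<le> e n * (\<Sum>z\<in>Z n. a n z)" for n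
  proof (cases "finite (Z n)")
    case True
    have an: "0 \<le> a n z" "a n z \<le> 1" "a n z \<le> e n" if "z \<in> Z n" for z
      using a[OF that] by auto
    have eq: "exp (- (\<Sum>z\<in>Z n. a n z)) = (\<Prod>z\<in>Z n. exp (- a n z))"
      using exp_sum[OF True, of "\<lambda>z. - a n z"] by (simp add: sum_negf)
    have "norm ((\<Prod>z\<in>Z n. 1 - a n z) - (\<Prod>z\<in>Z n. exp (- a n z))) \<le> (\<Sum>z\<in>Z n. norm (1 - a n z - exp (- a n z)))"
      by (rule norm_prod_diff) (simp_all add: an abs_le_iff order_trans[OF an(2)])
    also have "\<dots> \<le> (\<Sum>z\<in>Z n. e n * a n z)"
    proof (rule sum_mono)
      fix z assume z: "z \<in> Z n"
      have "norm (1 - a n z - exp (- a n z)) \<le> a n z * a n z"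
        using bound an(1,2)[OF z] by simp
      also have "\<dots> \<le> e n * a n z"
        using an[OF z] by (intro mult_right_mono)
      finally show "norm (1 - a n z - exp (- a n z)) \<le> e n * a n z" .
    qed
    finally show ?thesis by (simp add: eq sum_distrib_left)
  \<comment> \<open>For an infinite index set the product is 1 and the sum is 0 by convention, so
    the bound reads 0 <= 0.\<close>
  qed simp
  have "(\<lambda>n. e n * (\<Sum>z\<in>Z n. a n z)) \<longlonglongrightarrow> 0"
    using tendsto_mult[OF \<open>e \<longlonglongrightarrow> 0\<close> lim] by simp
  then have "(\<lambda>n. (\<Prod>z\<in>Z n. 1 - a n z) - exp (- (\<Sum>z\<in>Z n. a n z))) \<longlonglongrightarrow> 0"
    by (rule Lim_null_comparison[rotated], intro always_eventually allI, unfold real_norm_def, intro dev)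
  from tendsto_add[OF this tendsto_exp[OF tendsto_minus[OF lim]]] show ?thesis
    by simp
qed

section \<open>Frontiers of p-convex sets and rounding of box sides\<close>

lemma p_convex_compact: "p_convex p C \<Longrightarrow> compact C"
  by (auto simp: p_convex_def convex_body_def intro!: compact_UN)

lemma p_convex_negligible_frontier:
  assumes "p_convex p C"
  shows "negligible (frontier C)"
proof -
  obtain B where B: "\<And>i. i < p \<Longrightarrow> convex_body (B i)" and C: "C = (\<Union>i<p. B i)"
    using assms by (auto simp: p_convex_def)
  have "frontier C \<subseteq> (\<Union>i<p. frontier (B i))"
    unfolding C using frontier_Union_subset[of "B ` {..<p}"] by auto
  moreover have "negligible (\<Union>i<p. frontier (B i))"
    using B by (intro negligible_Union) (auto simp: convex_body_def negligible_convex_frontier)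
  ultimately show ?thesis by (rule negligible_subset[rotated])
qed

lemma tendsto_floor_ratio:
  fixes b :: "nat \<Rightarrow> real"
  assumes "filterlim b at_top sequentially"
  shows "(\<lambda>n. of_int \<lfloor>b n\<rfloor> / b n) \<longlonglongrightarrow> 1"
proof -
  have pos: "eventually (\<lambda>n. 0 < b n) sequentially"
    using assms by (simp add: filterlim_at_top_dense)
  have inv: "(\<lambda>n. 1 / b n) \<longlonglongrightarrow> 0"
    by (intro tendsto_divide_0[OF tendsto_const] filterlim_at_top_imp_at_infinity assms)
  have "(\<lambda>n. of_int \<lfloor>b n\<rfloor> / b n - 1) \<longlonglongrightarrow> 0"
  proof (rule Lim_null_comparison[OF _ inv])
    show "eventually (\<lambda>n. norm (of_int \<lfloor>b n\<rfloor> / b n - 1) \<le> 1 / b n) sequentially"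
      using pos
    proof eventually_elim
      case (elim n)
      have "of_int \<lfloor>b n\<rfloor> / b n - 1 = (of_int \<lfloor>b n\<rfloor> - b n) / b n"
        using elim by (simp add: diff_divide_distrib)
      moreover have "\<bar>of_int \<lfloor>b n\<rfloor> - b n\<bar> \<le> 1" by linarith
      ultimately show ?case using elim by (simp add: divide_right_mono)
    qed
  qed
  then show ?thesis by (simp add: LIM_zero_iff)
qed

text \<open>Box sides are floors and may vanish for small n, so positivity of the mesh is available
  only eventually. A shift of the sequence removes this defect.\<close>

lemma riemann_sum_lattice_eventually:
  fixes s :: "nat \<Rightarrow> real ^ 'd" and h :: "real ^ 'd \<Rightarrow> real"
  assumes "eventually (\<lambda>n. \<forall>i. 0 < s n $ i) sequentially" and "s \<longlonglongrightarrow> 0"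
    and "compact C" "negligible (frontier C)" "continuous_on C h"
  shows "(\<lambda>n. (\<Sum>z | of_lattice z * s n \<in> C. h (of_lattice z * s n)) * (\<Prod>i\<in>UNIV. s n $ i))
    \<longlonglongrightarrow> (LINT y:C|lborel. h y)"
proof -
  obtain N where "\<And>n i. n \<ge> N \<Longrightarrow> 0 < s n $ i"
    using assms(1) by (auto simp: eventually_sequentially)
  then have "(\<lambda>n. (\<Sum>z | of_lattice z * s (n + N) \<in> C. h (of_lattice z * s (n + N))) * (\<Prod>i\<in>UNIV. s (n + N) $ i))
      \<longlonglongrightarrow> (LINT y:C|lborel. h y)"
    using LIMSEQ_ignore_initial_segment[OF assms(2), of N] assms(3-5)
    by (intro riemann_sum_lattice) simp_all
  then show ?thesis by (rule LIMSEQ_offset)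
qed

section \<open>The Laplace functional of a Poisson measure\<close>

text \<open>This is the probability generating function of the Poisson law. At s = 1 it gives total
  mass one, at an exponential it gives the Laplace transform.\<close>

lemma exp_sums_poisson:
  fixes l :: real
  shows "(\<lambda>j. s ^ j * (l ^ j / fact j * exp (- l))) sums exp (- (l * (1 - s)))"
proof -
  have "(\<lambda>j. (s * l) ^ j /\<^sub>R fact j * exp (- l)) sums (exp (s * l) * exp (- l))"
    by (intro sums_mult2 exp_converges)
  then show ?thesis
    by (simp add: power_mult_distrib field_simps flip: exp_add)
qed

text \<open>A Poisson measure is specified through the probabilities of natural values only. These
  sum to one, so other values, infinity included, have probability zero.\<close>

lemma AE_poisson_nat:
  fixes X :: "'b \<Rightarrow> ennreal" and l :: real
  assumes "prob_space P" and [measurable]: "X \<in> borel_measurable P"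
    and pois: "\<And>j::nat. \<P>(\<omega> in P. X \<omega> = of_nat j) = l ^ j / fact j * exp (- l)"
  shows "AE \<omega> in P. \<exists>j::nat. X \<omega> = of_nat j"
proof -
  interpret prob_space P by fact
  let ?A = "\<lambda>j::nat. {\<omega>\<in>space P. X \<omega> = of_nat j}"
  have "(\<lambda>j. prob (?A j)) sums prob (\<Union>j. ?A j)"
    by (rule finite_measure_UNION) (auto simp: disjoint_family_on_def)
  then have "prob (\<Union>j. ?A j) = 1"
    using exp_sums_poisson[of 1 l] sums_unique2 by (fastforce simp: pois)
  moreover have "(\<Union>j. ?A j) = {\<omega>\<in>space P. \<exists>j::nat. X \<omega> = of_nat j}" by auto
  ultimately show ?thesis
    by (subst prob_Collect_eq_1[symmetric]) auto
qed

text \<open>Almost surely the integrand is a series in j with a single nonzero term. All terms are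
  nonnegative, so integral and series may be exchanged in the extended reals.\<close>

lemma laplace_poisson:
  fixes X :: "'b \<Rightarrow> ennreal" and l s :: real
  assumes "prob_space P" and [measurable]: "X \<in> borel_measurable P"
    and pois: "\<And>j::nat. \<P>(\<omega> in P. X \<omega> = of_nat j) = l ^ j / fact j * exp (- l)"
    and "0 \<le> s"
  shows "(\<integral>\<omega>. exp (- (s * enn2real (X \<omega>))) \<partial>P) = exp (- (l * (1 - exp (- s))))"
proof -
  interpret prob_space P by fact
  let ?A = "\<lambda>j::nat. {\<omega>\<in>space P. X \<omega> = of_nat j}"
  have "AE \<omega> in P. ennreal (exp (- (s * enn2real (X \<omega>)))) = (\<Sum>j. ennreal (exp (- s) ^ j) * indicator (?A j) \<omega>)"
    using AE_poisson_nat[OF assms(1-3)] AE_space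
  proof eventually_elim
    case (elim \<omega>)
    then obtain i :: nat where i: "X \<omega> = of_nat i" by blast
    have "(\<Sum>j. ennreal (exp (- s) ^ j) * indicator (?A j) \<omega>)
        = (\<Sum>j\<in>{i}. ennreal (exp (- s) ^ j) * indicator (?A j) \<omega>)"
      using i by (intro suminf_finite) (auto simp: indicator_def)
    then show ?case
      using i elim by (simp add: exp_of_nat_mult[symmetric] mult.commute)
  qed
  then have "(\<integral>\<^sup>+\<omega>. ennreal (exp (- (s * enn2real (X \<omega>)))) \<partial>P)
      = (\<integral>\<^sup>+\<omega>. (\<Sum>j. ennreal (exp (- s) ^ j) * indicator (?A j) \<omega>) \<partial>P)"
    by (rule nn_integral_cong_AE)
  also have "\<dots> = (\<Sum>j. ennreal (exp (- s) ^ j) * emeasure P (?A j))"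
    by (subst nn_integral_suminf) (auto simp: nn_integral_cmult_indicator)
  also have "\<dots> = (\<Sum>j. ennreal (exp (- s) ^ j * (l ^ j / fact j * exp (- l))))"
    by (simp only: emeasure_eq_measure pois ennreal_mult'[OF zero_le_power[OF exp_ge_zero]])
  also have "\<dots> = ennreal (exp (- (l * (1 - exp (- s)))))"
  proof (rule suminf_ennreal_eq)
    show "0 \<le> exp (- s) ^ j * (l ^ j / fact j * exp (- l))" for j
      unfolding pois[symmetric] by simp
  qed (rule exp_sums_poisson)
  finally show ?thesis
    by (subst integral_eq_nn_integral) auto
qed

lemma integral_nat_valued:
  fixes \<phi> :: "nat \<Rightarrow> real"
  assumes "finite_measure \<nu>" and [measurable]: "g \<in> measurable \<nu> (count_space UNIV)"
    and "\<And>y. y \<in> space \<nu> \<Longrightarrow> g y < J"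
  shows "(\<integral>y. \<phi> (g y) \<partial>\<nu>) = (\<Sum>j<J. \<phi> j * measure \<nu> {y\<in>space \<nu>. g y = j})"
proof -
  interpret finite_measure \<nu> by fact
  have "(\<integral>y. \<phi> (g y) \<partial>\<nu>) = (\<integral>y. (\<Sum>j<J. \<phi> j * indicator {y\<in>space \<nu>. g y = j} y) \<partial>\<nu>)"
  proof (rule Bochner_Integration.integral_cong[OF refl])
    fix y assume y: "y \<in> space \<nu>"
    have "(\<Sum>j<J. \<phi> j * indicator {y\<in>space \<nu>. g y = j} y) = (\<Sum>j<J. if j = g y then \<phi> j else 0)"
      using y by (intro sum.cong) (auto simp: indicator_def)
    then show "\<phi> (g y) = (\<Sum>j<J. \<phi> j * indicator {y\<in>space \<nu>. g y = j} y)"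
      using assms(3)[OF y] by simp
  qed
  also have "\<dots> = (\<Sum>j<J. \<phi> j * measure \<nu> {y\<in>space \<nu>. g y = j})"
    by (subst Bochner_Integration.integral_sum)
      (auto simp: emeasure_eq_measure intro!: integrable_mult_right)
  finally show ?thesis .
qed

lemma measurable_nn_integral_random_measure:
  assumes N: "random_measure P C N"
    and f: "f \<in> borel_measurable (restrict_space borel C)"
  shows "(\<lambda>\<omega>. \<integral>\<^sup>+y. f y \<partial>(N \<omega>)) \<in> borel_measurable P"
  using f
proof (induction rule: borel_measurable_induct)
  have sets: "sets (N \<omega>) = sets (restrict_space borel C)" if "\<omega> \<in> space P" for \<omega>
    using N that by (simp add: random_measure_def)
  have meas: "u \<in> borel_measurable (N \<omega>)"
    if "u \<in> borel_measurable (restrict_space borel C)" "\<omega> \<in> space P" for u :: "_ \<Rightarrow> ennreal" and \<omega>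
    using that measurable_cong_sets[OF sets refl] by blast
  {
    case (cong f g)
    have "(\<integral>\<^sup>+y. f y \<partial>(N \<omega>)) = (\<integral>\<^sup>+y. g y \<partial>(N \<omega>))" if "\<omega> \<in> space P" for \<omega>
      using cong(3) sets_eq_imp_space_eq[OF sets[OF that]] by (intro nn_integral_cong) auto
    then show ?case using cong(4) by (simp cong: measurable_cong)
  next
    case (set A)
    have "(\<lambda>\<omega>. emeasure (N \<omega>) A) \<in> borel_measurable P"
      using N set by (auto simp: random_measure_def)
    moreover have "(\<integral>\<^sup>+y. indicator A y \<partial>(N \<omega>)) = emeasure (N \<omega>) A" if "\<omega> \<in> space P" for \<omega>
      using sets[OF that] set by simp
    ultimately show ?case by (simp cong: measurable_cong)
  next
    case (mult u c)
    have "(\<integral>\<^sup>+y. c * u y \<partial>(N \<omega>)) = c * (\<integral>\<^sup>+y. u y \<partial>(N \<omega>))" if "\<omega> \<in> space P" for \<omega>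
      using meas[OF mult(2) that] by (rule nn_integral_cmult)
    then show ?case using mult(4) by (simp cong: measurable_cong)
  next
    case (add u v)
    have "(\<integral>\<^sup>+y. v y + u y \<partial>(N \<omega>)) = (\<integral>\<^sup>+y. v y \<partial>(N \<omega>)) + (\<integral>\<^sup>+y. u y \<partial>(N \<omega>))" if "\<omega> \<in> space P" for \<omega>
      using meas[OF add(1) that] meas[OF add(3) that] by (simp add: nn_integral_add)
    then show ?case using add by (simp cong: measurable_cong)
  next
    case (seq U)
    have "(\<integral>\<^sup>+y. (SUP i. U i) y \<partial>(N \<omega>)) = (SUP i. \<integral>\<^sup>+y. U i y \<partial>(N \<omega>))" if "\<omega> \<in> space P" for \<omega>
      using meas[OF seq(1) that] seq(3,4) by (simp add: nn_integral_monotone_convergence_SUP image_comp)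
    then show ?case using seq by (simp cong: measurable_cong)
  }
qed

text \<open>For nonnegative \<open>f\<close> the Bochner integral is \<open>enn2real\<close> of the
  nonnegative integral. This includes the case of an infinite integral, where both are 0 by
  convention.\<close>

lemma measurable_integral_random_measure:
  fixes f :: "_ \<Rightarrow> real"
  assumes N: "random_measure P C N"
    and f: "f \<in> borel_measurable (restrict_space borel C)" and nonneg: "\<And>y. y \<in> C \<Longrightarrow> 0 \<le> f y"
  shows "(\<lambda>\<omega>. \<integral>y. f y \<partial>(N \<omega>)) \<in> borel_measurable P"
proof -
  have "(\<lambda>\<omega>. enn2real (\<integral>\<^sup>+y. ennreal (f y) \<partial>(N \<omega>))) \<in> borel_measurable P"
    using measurable_nn_integral_random_measure[OF N, of "\<lambda>y. ennreal (f y)"] f by simp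
  moreover have "(\<integral>y. f y \<partial>(N \<omega>)) = enn2real (\<integral>\<^sup>+y. ennreal (f y) \<partial>(N \<omega>))" if "\<omega> \<in> space P" for \<omega>
  proof (rule integral_eq_nn_integral)
    have s: "sets (N \<omega>) = sets (restrict_space borel C)"
      using N that by (simp add: random_measure_def)
    show "f \<in> borel_measurable (N \<omega>)" using f measurable_cong_sets[OF s refl] by blast
    show "AE y in N \<omega>. 0 \<le> f y"
      using nonneg sets_eq_imp_space_eq[OF s] by (intro AE_I2) (simp add: space_restrict_space)
  qed
  ultimately show ?thesis by (simp cong: measurable_cong)
qed

text \<open>The total mass on C is Poisson with a finite parameter. Finiteness makes bounded
  functions integrable with respect to a realisation \<open>N \<omega>\<close>.\<close>

lemma AE_finite_poisson_measure:
  assumes "prob_space P" and N: "homogeneous_poisson_measure P C l N"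
    and C: "C \<in> sets borel" "emeasure lborel C < \<infinity>"
  shows "AE \<omega> in P. finite_measure (N \<omega>)"
proof -
  interpret prob_space P by fact
  have rm: "random_measure P C N" using N by (simp add: homogeneous_poisson_measure_def)
  have CR: "C \<in> sets (restrict_space borel C)" using C by (simp add: sets_restrict_space_iff)
  have "AE \<omega> in P. \<exists>j::nat. emeasure (N \<omega>) C = of_nat j"
  proof (rule AE_poisson_nat)
    show "(\<lambda>\<omega>. emeasure (N \<omega>) C) \<in> borel_measurable P"
      using rm CR by (simp add: random_measure_def)
    show "\<P>(\<omega> in P. emeasure (N \<omega>) C = of_nat j)
        = (l * measure lborel C) ^ j / fact j * exp (- (l * measure lborel C))" for j
      using N CR C(2) by (simp add: homogeneous_poisson_measure_def)
  qed fact
  then show ?thesis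
    using AE_space
  proof eventually_elim
    case (elim \<omega>)
    have "space (N \<omega>) = C"
      using rm elim sets_eq_imp_space_eq[of "N \<omega>"] by (simp add: random_measure_def space_restrict_space)
    then show ?case using elim(1) by (auto intro!: finite_measureI)
  qed
qed

text \<open>On the disjoint level sets \<open>A j\<close> the integral is a finite combination of
  the values \<open>N (A j)\<close>. These are independent Poisson variables, so the Laplace
  transform is a product of one-dimensional ones.\<close>

lemma laplace_poisson_step:
  fixes g :: "_ \<Rightarrow> nat" and \<phi> :: "nat \<Rightarrow> real"
  assumes "prob_space P" and N: "homogeneous_poisson_measure P C l N"
    and C: "C \<in> sets borel" "emeasure lborel C < \<infinity>"
    and g: "g \<in> measurable (restrict_space borel C) (count_space UNIV)"
    and bound: "\<And>y. y \<in> C \<Longrightarrow> g y < J" and \<phi>: "\<And>j. 0 \<le> \<phi> j"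
  shows "(\<integral>\<omega>. exp (- (\<integral>y. \<phi> (g y) \<partial>(N \<omega>))) \<partial>P)
    = exp (- (l * (\<integral>y. 1 - exp (- \<phi> (g y)) \<partial>(restrict_space lborel C))))"
proof -
  interpret prob_space P by fact
  have rm: "random_measure P C N" using N by (simp add: homogeneous_poisson_measure_def)
  define A where "A j = {y\<in>C. g y = j}" for j
  have A: "A j \<in> sets (restrict_space borel C)" for j
    using measurable_sets[OF g, of "{j}"] by (simp add: A_def space_restrict_space vimage_def Int_def conj_commute)
  have A_fin: "emeasure lborel (A j) < \<infinity>" for j
  proof -
    have "emeasure lborel (A j) \<le> emeasure lborel C"
      using C by (intro emeasure_mono) (auto simp: A_def)
    then show ?thesis using C(2) by (auto simp: less_top[symmetric] top_unique)
  qed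
  have X [measurable]: "(\<lambda>\<omega>. emeasure (N \<omega>) (A j)) \<in> borel_measurable P" for j
    using rm A by (simp add: random_measure_def)
  have indep: "indep_vars (\<lambda>_. borel) (\<lambda>j \<omega>. emeasure (N \<omega>) (A j)) {..<J}"
  proof -
    have "disjoint_family_on A {..<J}" by (auto simp: disjoint_family_on_def A_def)
    then show ?thesis using N A unfolding homogeneous_poisson_measure_def by blast
  qed
  define F where "F j X = exp (- (\<phi> j * enn2real X))" for j X
  have F [measurable]: "F j \<in> borel_measurable borel" for j unfolding F_def by measurable
  have [measurable]: "(\<lambda>\<omega>. \<integral>y. \<phi> (g y) \<partial>(N \<omega>)) \<in> borel_measurable P"
    using measurable_compose[OF g, of \<phi>] \<phi> by (intro measurable_integral_random_measure[OF rm]) auto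
  have "AE \<omega> in P. exp (- (\<integral>y. \<phi> (g y) \<partial>(N \<omega>))) = (\<Prod>j<J. F j (emeasure (N \<omega>) (A j)))"
    using AE_finite_poisson_measure[OF \<open>prob_space P\<close> N C] AE_space
  proof eventually_elim
    case (elim \<omega>)
    have s: "sets (N \<omega>) = sets (restrict_space borel C)"
      using rm elim by (simp add: random_measure_def)
    then have sp: "space (N \<omega>) = C"
      using sets_eq_imp_space_eq[OF s] by (simp add: space_restrict_space)
    have "(\<integral>y. \<phi> (g y) \<partial>(N \<omega>)) = (\<Sum>j<J. \<phi> j * measure (N \<omega>) {y\<in>space (N \<omega>). g y = j})"
      using elim g measurable_cong_sets[OF s refl] bound sp by (intro integral_nat_valued) blast+
    then show ?case
      by (simp add: sp F_def A_def measure_def exp_sum flip: sum_negf)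
  qed
  then have "(\<integral>\<omega>. exp (- (\<integral>y. \<phi> (g y) \<partial>(N \<omega>))) \<partial>P) = (\<integral>\<omega>. (\<Prod>j<J. F j (emeasure (N \<omega>) (A j))) \<partial>P)"
    by (intro integral_cong_AE) auto
  also have "\<dots> = (\<Prod>j<J. (\<integral>\<omega>. F j (emeasure (N \<omega>) (A j)) \<partial>P))"
  proof (rule indep_vars_lebesgue_integral)
    show "indep_vars (\<lambda>_. borel) (\<lambda>j \<omega>. F j (emeasure (N \<omega>) (A j))) {..<J}"
      by (rule indep_vars_compose2[OF indep]) auto
    show "integrable P (\<lambda>\<omega>. F j (emeasure (N \<omega>) (A j)))" for j
      by (rule integrable_const_bound[of _ 1]) (auto simp: F_def \<phi>)
  qed simp
  also have "\<dots> = (\<Prod>j<J. exp (- (l * measure lborel (A j) * (1 - exp (- \<phi> j)))))"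
    unfolding F_def
  proof (intro prod.cong refl laplace_poisson)
    show "\<P>(\<omega> in P. emeasure (N \<omega>) (A j) = of_nat i)
        = (l * measure lborel (A j)) ^ i / fact i * exp (- (l * measure lborel (A j)))" for i j
      using N A A_fin unfolding homogeneous_poisson_measure_def by blast
  qed (auto simp: \<phi> \<open>prob_space P\<close>)
  also have "\<dots> = exp (- (l * (\<Sum>j<J. (1 - exp (- \<phi> j)) * measure lborel (A j))))"
    by (simp add: sum_distrib_left mult_ac flip: exp_sum sum_negf)
  also have "(\<Sum>j<J. (1 - exp (- \<phi> j)) * measure lborel (A j))
      = (\<Sum>j<J. (1 - exp (- \<phi> j)) * measure (restrict_space lborel C) {y\<in>space (restrict_space lborel C). g y = j})"
    using C by (simp add: A_def space_restrict_space measure_restrict_space)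
  also have "\<dots> = (\<integral>y. 1 - exp (- \<phi> (g y)) \<partial>(restrict_space lborel C))"
  proof (rule integral_nat_valued[symmetric])
    show "finite_measure (restrict_space lborel C)"
      using C by (intro finite_measureI) (simp add: space_restrict_space emeasure_restrict_space)
    show "g \<in> measurable (restrict_space lborel C) (count_space UNIV)"
      using g by (simp add: measurable_cong_sets[OF sets_restrict_space_cong[OF sets_lborel] refl])
  qed (auto simp: space_restrict_space bound)
  finally show ?thesis .
qed

text \<open>Rounding \<open>f\<close> down to multiples of 1 / (m + 1) gives functions with finitely
  many levels, because \<open>f\<close> is bounded on C. They converge pointwise, and the formula
  for step functions passes to the limit.\<close>

lemma laplace_poisson_measure:
  fixes f :: "_ \<Rightarrow> real"
  assumes "prob_space P" and N: "homogeneous_poisson_measure P C l N"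
    and C: "C \<in> sets borel" "emeasure lborel C < \<infinity>"
    and f: "f \<in> borel_measurable (restrict_space borel C)"
    and bounds: "\<And>y. y \<in> C \<Longrightarrow> 0 \<le> f y" "\<And>y. y \<in> C \<Longrightarrow> f y \<le> B"
  shows "(\<integral>\<omega>. exp (- (\<integral>y. f y \<partial>(N \<omega>))) \<partial>P) = exp (- (l * (LINT y:C|lborel. 1 - exp (- f y))))"
proof -
  interpret prob_space P by fact
  have rm: "random_measure P C N" using N by (simp add: homogeneous_poisson_measure_def)
  define g where "g m y = nat \<lfloor>real (Suc m) * f y\<rfloor>" for m y
  define f' where "f' m y = real (g m y) / real (Suc m)" for m y
  have g: "g m \<in> measurable (restrict_space borel C) (count_space UNIV)" for m
    unfolding g_def using f by measurable
  have f': "f' m \<in> borel_measurable (restrict_space borel C)" for m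
    unfolding f'_def using measurable_compose[OF g, of "\<lambda>j. real j / real (Suc m)"] by simp
  have f'_bounds: "0 \<le> f' m y" "f' m y \<le> f y" "f y - f' m y \<le> 1 / real (Suc m)" if "y \<in> C" for m y
  proof -
    have "0 \<le> real (Suc m) * f y" using bounds(1)[OF that] by simp
    then have g: "real (g m y) = of_int \<lfloor>real (Suc m) * f y\<rfloor>" unfolding g_def by simp
    show "0 \<le> f' m y" by (simp add: f'_def)
    have "real (g m y) \<le> real (Suc m) * f y" "real (Suc m) * f y - real (g m y) \<le> 1"
      unfolding g by linarith+
    then have "real (g m y) / real (Suc m) \<le> f y" "f y \<le> (real (g m y) + 1) / real (Suc m)"
      by (simp_all add: pos_divide_le_eq pos_le_divide_eq mult.commute del: of_nat_Suc)
    then show "f' m y \<le> f y" "f y - f' m y \<le> 1 / real (Suc m)"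
      unfolding f'_def add_divide_distrib by simp_all
  qed
  have f'_lim: "(\<lambda>m. f' m y) \<longlonglongrightarrow> f y" if "y \<in> C" for y
  proof -
    have "(\<lambda>m. f y - f' m y) \<longlonglongrightarrow> 0"
      using f'_bounds[OF that]
      by (intro Lim_null_comparison[OF _ LIMSEQ_inverse_real_of_nat]) (auto simp: inverse_eq_divide)
    then have "(\<lambda>m. f y - (f y - f' m y)) \<longlonglongrightarrow> f y - 0" by (intro tendsto_intros)
    then show ?thesis by simp
  qed
  \<comment> \<open>Two limits are taken this way: with the identity for realisations of the Poisson
    measure, and with 1 - exp (- u) for Lebesgue measure on C. The bound on \<open>\<psi>\<close>
    makes the constant B a dominating function for both.\<close>
  have lim_int: "(\<lambda>m. \<integral>y. \<psi> (f' m y) \<partial>\<nu>) \<longlonglongrightarrow> (\<integral>y. \<psi> (f y) \<partial>\<nu>)"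
    if "finite_measure \<nu>" and s: "sets \<nu> = sets (restrict_space borel C)"
      and \<psi>: "continuous_on UNIV \<psi>" "\<And>u. 0 \<le> u \<Longrightarrow> \<bar>\<psi> u\<bar> \<le> u" for \<nu> and \<psi> :: "real \<Rightarrow> real"
  proof -
    interpret \<nu>: finite_measure \<nu> by fact
    have sp: "space \<nu> = C" using sets_eq_imp_space_eq[OF s] by (simp add: space_restrict_space)
    have [measurable]: "\<psi> \<in> borel_measurable borel" using \<psi>(1) by (rule borel_measurable_continuous_onI)
    have [measurable]: "f \<in> borel_measurable \<nu>" "f' m \<in> borel_measurable \<nu>" for m
      using f f' measurable_cong_sets[OF s refl] by blast+
    show ?thesis
    proof (rule integral_dominated_convergence[where w = "\<lambda>_. B"])
      show "AE y in \<nu>. (\<lambda>m. \<psi> (f' m y)) \<longlonglongrightarrow> \<psi> (f y)"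
        using f'_lim \<psi>(1) sp by (intro AE_I2) (auto intro!: continuous_on_tendsto_compose[OF \<psi>(1)])
      have "\<bar>\<psi> (f' m y)\<bar> \<le> B" if "y \<in> C" for m y
        using \<psi>(2)[of "f' m y"] f'_bounds(1,2)[OF that, of m] bounds(2)[OF that] by linarith
      then show "AE y in \<nu>. norm (\<psi> (f' m y)) \<le> B" for m
        using sp by (intro AE_I2) simp
    qed simp_all
  qed
  have fin: "finite_measure (restrict_space lborel C)"
    using C by (intro finite_measureI) (simp add: space_restrict_space emeasure_restrict_space)
  have step: "(\<integral>\<omega>. exp (- (\<integral>y. f' m y \<partial>(N \<omega>))) \<partial>P)
      = exp (- (l * (\<integral>y. 1 - exp (- f' m y) \<partial>(restrict_space lborel C))))" for m
  proof -
    have "g m y < Suc (nat \<lfloor>real (Suc m) * B\<rfloor>)" if "y \<in> C" for y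
      unfolding g_def using bounds[OF that]
      by (auto simp: less_Suc_eq_le intro!: nat_mono floor_mono mult_left_mono)
    then show ?thesis
      unfolding f'_def by (intro laplace_poisson_step[OF \<open>prob_space P\<close> N C g]) auto
  qed
  have meas: "(\<lambda>\<omega>. \<integral>y. f' m y \<partial>(N \<omega>)) \<in> borel_measurable P" "(\<lambda>\<omega>. \<integral>y. f y \<partial>(N \<omega>)) \<in> borel_measurable P" for m
    using f f' f'_bounds(1) bounds(1) by (auto intro!: measurable_integral_random_measure[OF rm])
  have "(\<lambda>m. \<integral>\<omega>. exp (- (\<integral>y. f' m y \<partial>(N \<omega>))) \<partial>P) \<longlonglongrightarrow> (\<integral>\<omega>. exp (- (\<integral>y. f y \<partial>(N \<omega>))) \<partial>P)"
  proof (rule integral_dominated_convergence[where w = "\<lambda>_. 1"])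
    show "AE \<omega> in P. (\<lambda>m. exp (- (\<integral>y. f' m y \<partial>(N \<omega>)))) \<longlonglongrightarrow> exp (- (\<integral>y. f y \<partial>(N \<omega>)))"
      using AE_finite_poisson_measure[OF \<open>prob_space P\<close> N C] AE_space
    proof eventually_elim
      case (elim \<omega>)
      then show ?case
        using lim_int[of "N \<omega>" "\<lambda>u. u"] rm by (intro tendsto_intros) (auto simp: random_measure_def)
    qed
    have "0 \<le> (\<integral>y. f' m y \<partial>(N \<omega>))" for m \<omega>
      by (rule integral_nonneg_AE) (simp add: f'_def)
    then show "AE \<omega> in P. norm (exp (- (\<integral>y. f' m y \<partial>(N \<omega>)))) \<le> 1" for m
      by (intro AE_I2) simp
  qed (use meas in auto)
  moreover have "(\<lambda>m. \<integral>\<omega>. exp (- (\<integral>y. f' m y \<partial>(N \<omega>))) \<partial>P)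
      \<longlonglongrightarrow> exp (- (l * (\<integral>y. 1 - exp (- f y) \<partial>(restrict_space lborel C))))"
  proof -
    have "\<bar>1 - exp (- u)\<bar> \<le> u" if "0 \<le> u" for u :: real
      using that exp_ge_add_one_self[of "- u"] by simp
    then show ?thesis
      unfolding step
      by (intro tendsto_intros lim_int[of _ "\<lambda>u. 1 - exp (- u)"] fin continuous_intros)
        (simp_all add: sets_restrict_space_cong[OF sets_lborel])
  qed
  ultimately have "(\<integral>\<omega>. exp (- (\<integral>y. f y \<partial>(N \<omega>))) \<partial>P)
      = exp (- (l * (\<integral>y. 1 - exp (- f y) \<partial>(restrict_space lborel C))))"
    by (rule LIMSEQ_unique)
  then show ?thesis
    using C by (simp add: integral_restrict_space set_lebesgue_integral_def)
qed

section \<open>The cluster process\<close>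

lemma sets_cluster_process [simp]:
  "sets (cluster_process \<xi> x c k C \<omega>) = sets (restrict_space borel C)"
  unfolding cluster_process_def
  using sets.sigma_sets_eq[of "restrict_space borel C"] sets.space_closed[of "restrict_space borel C"]
  by (simp add: space_restrict_space)

lemma space_cluster_process [simp]: "space (cluster_process \<xi> x c k C \<omega>) = C"
  using sets_eq_imp_space_eq[OF sets_cluster_process] by (simp add: space_restrict_space)

text \<open>The mesh of the lattice that carries the atoms in the coordinates of C. It turns sums
  over boxes into the Riemann sums above.\<close>

definition cell_side :: "real ^ 'd \<Rightarrow> nat \<Rightarrow> real ^ 'd" where
  "cell_side c k = (\<chi> i. box_side c k $ i / c $ i)"

lemma cell_corner_eq: "(\<chi> i. real_of_int (z $ i) * box_side c k $ i / c $ i) = of_lattice z * cell_side c k"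
  by (simp add: vec_eq_iff of_lattice_def cell_side_def)

text \<open>As the image of a weighted counting measure the process admits change of variables, so
  its integrals become finite sums over boxes.\<close>

lemma cluster_process_eq_distr:
  "cluster_process \<xi> x c k C \<omega> =
    distr (density (count_space {z. of_lattice z * cell_side c k \<in> C})
        (\<lambda>z. of_bool (field_max \<xi> (J_box c k z) \<omega> > ereal x)))
      (restrict_space borel C) (\<lambda>z. of_lattice z * cell_side c k)"
  (is "_ = distr (density (count_space ?Z) ?u) _ ?y")
proof (rule measure_eqI)
  fix A assume "A \<in> sets (cluster_process \<xi> x c k C \<omega>)"
  then have A: "A \<in> sets (restrict_space borel C)" by simp
  then have "A \<subseteq> C" using sets.sets_into_space[OF A] by (simp add: space_restrict_space)
  have y: "?y \<in> measurable (density (count_space ?Z) ?u) (restrict_space borel C)"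
    by (auto simp: measurable_count_space_eq1 space_restrict_space)
  show "emeasure (cluster_process \<xi> x c k C \<omega>) A = emeasure (distr (density (count_space ?Z) ?u) (restrict_space borel C) ?y) A"
    using \<open>A \<subseteq> C\<close>
    by (subst emeasure_distr[OF y A])
      (auto simp: emeasure_cluster_process[OF A] emeasure_density cell_corner_eq
        nn_integral_count_space_indicator[of ?Z] indicator_def intro!: nn_integral_cong)
qed simp

lemma integral_cluster_process:
  fixes f :: "_ \<Rightarrow> real"
  assumes fin: "finite {z. of_lattice z * cell_side c k \<in> C}" (is "finite ?Z")
    and f: "f \<in> borel_measurable (restrict_space borel C)"
  shows "(\<integral>u. f u \<partial>(cluster_process \<xi> x c k C \<omega>)) =
    (\<Sum>z | of_lattice z * cell_side c k \<in> C.
      f (of_lattice z * cell_side c k) * of_bool (field_max \<xi> (J_box c k z) \<omega> > ereal x))"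
proof -
  let ?D = "density (count_space ?Z) (\<lambda>z. of_bool (field_max \<xi> (J_box c k z) \<omega> > ereal x))"
  have D: "?D = density (count_space ?Z) (\<lambda>z. ennreal (of_bool (field_max \<xi> (J_box c k z) \<omega> > ereal x)))"
    by (intro density_cong) auto
  have "(\<integral>u. f u \<partial>(cluster_process \<xi> x c k C \<omega>)) = (\<integral>z. f (of_lattice z * cell_side c k) \<partial>?D)"
    unfolding cluster_process_eq_distr
    by (intro integral_distr f) (auto simp: measurable_count_space_eq1 space_restrict_space)
  also have "\<dots> = (\<integral>z. of_bool (field_max \<xi> (J_box c k z) \<omega> > ereal x) *\<^sub>R f (of_lattice z * cell_side c k) \<partial>count_space ?Z)"
    unfolding D by (intro integral_density) auto
  finally show ?thesis
    using fin by (simp add: lebesgue_integral_count_space_finite mult.commute)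
qed

lemma random_measure_cluster_process:
  fixes \<xi> :: "int ^ 'd \<Rightarrow> 'a \<Rightarrow> real"
  assumes [measurable]: "\<And>v. \<xi> v \<in> borel_measurable M"
  shows "random_measure M C (cluster_process \<xi> x c k C)"
  unfolding random_measure_def
proof (intro conjI ballI)
  fix A assume A: "A \<in> sets (restrict_space borel C)"
  interpret sigma_finite_measure "count_space (UNIV :: (int ^ 'd) set)"
    by (rule sigma_finite_measure_count_space)
  have [measurable]: "Measurable.pred M (\<lambda>\<omega>. field_max \<xi> V \<omega> > ereal x)" for V
    unfolding field_max_def less_SUP_iff by measurable
  show "(\<lambda>\<omega>. emeasure (cluster_process \<xi> x c k C \<omega>) A) \<in> borel_measurable M"
    unfolding emeasure_cluster_process[OF A]
    \<comment> \<open>The index z ranges over a countable type, so joint measurability in the pair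
      reduces to measurability in \<open>\<omega>\<close> for each fixed z.\<close>
    by (intro borel_measurable_nn_integral, unfold case_prod_beta,
        rule measurable_compose_countable'[where I = UNIV and g = snd]) auto
qed simp

section \<open>Boxes and stationary fields\<close>

text \<open>The case \<open>g = 0\<close> is the full box, so translation, counting and monotonicity
  are proved once for both kinds. The set is empty as soon as \<open>2 * g $ i\<close> reaches
  \<open>t $ i\<close> for some i.\<close>

definition trimmed_box :: "int ^ 'd \<Rightarrow> int ^ 'd \<Rightarrow> int ^ 'd \<Rightarrow> (int ^ 'd) set" where
  "trimmed_box t g z = {v. \<forall>i. v $ i \<in> {t $ i * z $ i + g $ i ..< t $ i * (z $ i + 1) - g $ i}}"

lemma finite_trimmed_box: "finite (trimmed_box t g z)"
  unfolding trimmed_box_def by (rule finite_vec_Pi) simp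

lemma is_box_trimmed_box: "is_box (trimmed_box t g z)"
proof -
  have "trimmed_box t g z = {(\<chi> i. t $ i * z $ i + g $ i)..(\<chi> i. t $ i * (z $ i + 1) - g $ i - 1)}"
    by (auto simp: trimmed_box_def less_eq_vec_def)
  then show ?thesis unfolding is_box_def by blast
qed

lemma trimmed_box_translate: "trimmed_box t g z = (+) (t * z) ` trimmed_box t g 0"
proof safe
  fix v assume "v \<in> trimmed_box t g z"
  then have "v - t * z \<in> trimmed_box t g 0"
    by (auto simp: trimmed_box_def algebra_simps)
  then show "v \<in> (+) (t * z) ` trimmed_box t g 0"
    by (rule rev_image_eqI) simp
qed (auto simp: trimmed_box_def algebra_simps)

lemma card_trimmed_box: "card (trimmed_box t g z) = (\<Prod>i\<in>UNIV. nat (t $ i - 2 * g $ i))"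
  unfolding trimmed_box_def by (subst card_vec_Pi) (simp add: algebra_simps)

lemma trimmed_box_mono: "(\<And>i. 0 \<le> g $ i) \<Longrightarrow> trimmed_box t g z \<subseteq> trimmed_box t 0 z"
  by (auto simp: trimmed_box_def) (smt (verit))+

lemma disjoint_boxes:
  fixes t :: "int ^ 'd"
  assumes "\<And>i. 0 < t $ i" "z \<noteq> z'"
  shows "trimmed_box t 0 z \<inter> trimmed_box t 0 z' = {}"
proof (rule ccontr)
  assume "\<not> ?thesis"
  then obtain v where v: "v \<in> trimmed_box t 0 z" "v \<in> trimmed_box t 0 z'" by blast
  have div: "v $ i div t $ i = z $ i" if "v \<in> trimmed_box t 0 z" for z i
  proof -
    have "t $ i * z $ i \<le> v $ i" "v $ i < t $ i * (z $ i + 1)"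
      using that by (auto simp: trimmed_box_def)
    then show ?thesis
      by (intro int_div_pos_eq[where r = "v $ i - t $ i * z $ i"]) (auto simp: algebra_simps)
  qed
  have "z = z'" using div[OF v(1)] div[OF v(2)] by (simp add: vec_eq_iff)
  then show False using assms(2) by simp
qed

text \<open>A vector of the unit ball has coordinates at most 1 in absolute value, so a
  \<open>\<gamma>\<close>-step from the trimmed box moves coordinate i by at most
  \<open>g $ i\<close> and stays in the full box, which \<open>B\<close> avoids.\<close>

lemma separated_trimmed_box:
  assumes g: "\<And>i. \<bar>\<gamma> $ i\<bar> \<le> of_int (g $ i)" and B: "B \<inter> trimmed_box t 0 z = {}"
  shows "separated \<gamma> (trimmed_box t g z) B"
  unfolding separated_def
proof clarify
  fix w assume "w \<in> B" and "of_lattice w \<in> of_lattice ` trimmed_box t g z + (*) \<gamma> ` cball 0 1"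
  then obtain v u where v: "v \<in> trimmed_box t g z" and u: "norm u \<le> 1" and eq: "of_lattice w = of_lattice v + \<gamma> * u"
    by (auto elim!: set_plus_elim)
  have "w \<in> trimmed_box t 0 z"
    unfolding trimmed_box_def
  proof clarify
    fix i
    have "\<bar>u $ i\<bar> \<le> 1" using u component_le_norm_cart[of u i] by linarith
    then have "\<bar>(\<gamma> * u) $ i\<bar> \<le> of_int (g $ i)"
      using g[of i] by (simp add: abs_mult) (smt (verit) mult_left_le abs_ge_zero)
    moreover have "(of_lattice w :: real ^ 'a) $ i = (of_lattice v + \<gamma> * u) $ i" using eq by simp
    ultimately have "\<bar>real_of_int (w $ i - v $ i)\<bar> \<le> of_int (g $ i)"
      by (simp add: of_lattice_def)
    then have "\<bar>w $ i - v $ i\<bar> \<le> g $ i" by linarith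
    then show "w $ i \<in> {t $ i * z $ i + (0 :: int ^ 'a) $ i ..< t $ i * (z $ i + 1) - (0 :: int ^ 'a) $ i}"
      using v by (auto simp: trimmed_box_def elim!: allE[of _ i])
  qed
  then show False using \<open>w \<in> B\<close> B by blast
qed

text \<open>The set A_0 of condition D^l, written with the integer box sides.\<close>

definition later_neighbours :: "(int ^ 'd) rel \<Rightarrow> int ^ 'd \<Rightarrow> (int ^ 'd) set" where
  "later_neighbours r t = {z. (0, z) \<in> r \<and> z \<noteq> 0 \<and> (\<forall>i. \<bar>z $ i\<bar> \<le> t $ i)}"

lemma translation_invariant_order_iff:
  assumes "translation_invariant_order r"
  shows "(u + w, v + w) \<in> r \<longleftrightarrow> (u, v) \<in> r"
proof -
  have "(u + w, v + w) \<in> r \<Longrightarrow> (u + w + (- w), v + w + (- w)) \<in> r"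
    using assms unfolding translation_invariant_order_def by blast
  then show ?thesis
    using assms unfolding translation_invariant_order_def by auto
qed

lemma linear_order_finite_greatest:
  assumes "linear_order r" and "finite X" and "X \<noteq> {}"
  obtains v where "v \<in> X" and "\<And>z. z \<in> X \<Longrightarrow> (z, v) \<in> r"
proof -
  have "\<exists>v\<in>X. \<forall>z\<in>X. (z, v) \<in> r"
    using assms(2,3)
  proof (induction rule: finite_ne_induct)
    case (singleton v)
    then show ?case using assms(1) by (auto simp: order_on_defs refl_on_def)
  next
    case (insert u X)
    then obtain v where v: "v \<in> X" "\<forall>z\<in>X. (z, v) \<in> r" by blast
    have "(u, u) \<in> r" "trans r"
      using assms(1) by (auto simp: order_on_defs refl_on_def)
    moreover have "(u, v) \<in> r \<or> (v, u) \<in> r"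
      using assms(1) by (cases "u = v") (auto simp: order_on_defs refl_on_def total_on_def)
    ultimately show ?case using v by (blast dest: transD)
  qed
  then show thesis using that by blast
qed

lemma A_set_eq_later_neighbours:
  fixes t :: "int ^ 'd"
  assumes "box_side c k = of_lattice t" and "\<And>i. 0 \<le> t $ i"
  shows "A_set r c k 0 = later_neighbours r t"
proof -
  have "z \<in> lattice_points ((+) (of_lattice 0) ` ((*) (box_side c k) ` cbox (-1) 1)) \<longleftrightarrow> (\<forall>i. \<bar>z $ i\<bar> \<le> t $ i)" for z
  proof
    assume "z \<in> lattice_points ((+) (of_lattice 0) ` ((*) (box_side c k) ` cbox (-1) 1))"
    then obtain y where y: "y \<in> cbox (-1) (1 :: real ^ 'd)" and eq: "of_lattice z = of_lattice 0 + of_lattice t * y"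
      by (auto simp: lattice_points_def assms(1))
    show "\<forall>i. \<bar>z $ i\<bar> \<le> t $ i"
    proof
      fix i
      have "\<bar>y $ i\<bar> \<le> 1" using y by (auto simp: mem_box_cart abs_le_iff elim!: allE[of _ i])
      then have "\<bar>of_int (t $ i) * y $ i\<bar> \<le> of_int (t $ i)"
        using assms(2)[of i] by (simp add: abs_mult mult_left_le)
      moreover have "real_of_int (z $ i) = of_int (t $ i) * y $ i"
        using arg_cong[OF eq, of "\<lambda>v. v $ i"] by (simp add: of_lattice_def)
      ultimately have "\<bar>real_of_int (z $ i)\<bar> \<le> of_int (t $ i)" by simp
      then show "\<bar>z $ i\<bar> \<le> t $ i" by linarith
    qed
  next
    assume z: "\<forall>i. \<bar>z $ i\<bar> \<le> t $ i"
    \<comment> \<open>A side of length 0 is allowed: it forces the coordinate of z to be 0, and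
      division by zero then makes the coordinate of y equal to 0.\<close>
    define y :: "real ^ 'd" where "y = (\<chi> i. of_int (z $ i) / of_int (t $ i))"
    have "\<bar>y $ i\<bar> \<le> 1" for i
      using z assms(2)[of i] by (auto simp: y_def divide_le_eq_1 elim!: allE[of _ i])
    then have "y \<in> cbox (-1) 1" by (auto simp: mem_box_cart abs_le_iff minus_le_iff)
    moreover have "of_lattice z = of_lattice 0 + of_lattice t * y"
    proof -
      have "t $ i = 0 \<Longrightarrow> z $ i = 0" for i using z[rule_format, of i] by simp
      then show ?thesis by (simp add: vec_eq_iff of_lattice_def y_def)
    qed
    ultimately show "z \<in> lattice_points ((+) (of_lattice 0) ` ((*) (box_side c k) ` cbox (-1) 1))"
      unfolding lattice_points_def assms(1) by blast
  qed
  then show ?thesis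
    by (auto simp: A_set_def later_neighbours_def)
qed

lemma in_I_box_iff:
  fixes t :: "int ^ 'd"
  assumes "box_side c k = of_lattice t" and "\<And>i. 0 < t $ i"
  shows "y \<in> I_box c k z \<longleftrightarrow>
    (\<forall>i. of_int (t $ i) * of_int (z $ i) \<le> y $ i \<and> y $ i < of_int (t $ i) * (of_int (z $ i) + 1))"
proof
  assume "y \<in> I_box c k z"
  then obtain u where u: "\<forall>i. 0 \<le> u $ i \<and> u $ i < 1" and y: "y = of_lattice t * (of_lattice z + u)"
    by (auto simp: I_box_def assms(1))
  have "0 < real_of_int (t $ i)" for i using assms(2)[of i] by simp
  then show "\<forall>i. of_int (t $ i) * of_int (z $ i) \<le> y $ i \<and> y $ i < of_int (t $ i) * (of_int (z $ i) + 1)"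
    using u by (simp add: y of_lattice_def)
next
  assume y: "\<forall>i. of_int (t $ i) * of_int (z $ i) \<le> y $ i \<and> y $ i < of_int (t $ i) * (of_int (z $ i) + 1)"
  define u :: "real ^ 'd" where "u = (\<chi> i. y $ i / of_int (t $ i) - of_int (z $ i))"
  have t: "0 < real_of_int (t $ i)" for i using assms(2)[of i] by simp
  have "\<forall>i. 0 \<le> u $ i \<and> u $ i < 1"
    using y t by (simp add: u_def field_simps)
  moreover have "y = of_lattice t * (of_lattice z + u)"
    using t by (simp add: vec_eq_iff u_def of_lattice_def less_imp_neq[THEN not_sym])
  ultimately show "y \<in> I_box c k z"
    unfolding I_box_def assms(1) by blast
qed

lemma J_box_eq_trimmed_box:
  fixes t :: "int ^ 'd"
  assumes "box_side c k = of_lattice t" and "\<And>i. 0 < t $ i"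
  shows "J_box c k z = trimmed_box t 0 z"
proof -
  have "(real_of_int (t $ i) * of_int (z $ i) \<le> of_int (v $ i) \<and> of_int (v $ i) < real_of_int (t $ i) * (of_int (z $ i) + 1))
      \<longleftrightarrow> (t $ i * z $ i \<le> v $ i \<and> v $ i < t $ i * (z $ i + 1))" for v i
  proof -
    have "real_of_int (t $ i) * of_int (z $ i) = of_int (t $ i * z $ i)"
      "real_of_int (t $ i) * (of_int (z $ i) + 1) = of_int (t $ i * (z $ i + 1))" by simp_all
    then show ?thesis by (simp only: of_int_le_iff of_int_less_iff)
  qed
  then show ?thesis
    by (auto simp: J_box_def lattice_points_def in_I_box_iff[OF assms] of_lattice_def trimmed_box_def)
qed

section \<open>Avoidance and exceedance events of a stationary field\<close>

locale stationary_random_field = prob_space M for M :: "'a measure" +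
  fixes \<xi> :: "int ^ 'd \<Rightarrow> 'a \<Rightarrow> real"
  assumes stationary: "stationary_field M \<xi>"
begin

text \<open>The event that the maximum over \<open>A\<close> is at most \<open>x\<close>, freed from
  extended real suprema. Unions of index sets become intersections of events.\<close>

definition below :: "real \<Rightarrow> (int ^ 'd) set \<Rightarrow> 'a set" where
  "below x A = {\<omega> \<in> space M. \<forall>v\<in>A. \<xi> v \<omega> \<le> x}"

lemma measurable_field [measurable]: "\<xi> v \<in> borel_measurable M"
  using stationary by (simp add: stationary_field_def)

lemma sets_below [measurable]: "below x A \<in> events"
  unfolding below_def by measurable

lemma below_Un: "below x (A \<union> B) = below x A \<inter> below x B"
  by (auto simp: below_def)

lemma below_UN: "below x (\<Union>i\<in>I. A i) = {\<omega>\<in>space M. \<forall>i\<in>I. \<omega> \<in> below x (A i)}"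
  by (auto simp: below_def)

lemma below_mono: "A \<subseteq> B \<Longrightarrow> below x B \<subseteq> below x A"
  by (auto simp: below_def)

lemma below_empty [simp]: "below x {} = space M"
  by (auto simp: below_def)

lemma field_max_le_iff: "\<omega> \<in> space M \<Longrightarrow> field_max \<xi> A \<omega> \<le> ereal x \<longleftrightarrow> \<omega> \<in> below x A"
  by (auto simp: field_max_def below_def SUP_le_iff)

lemma prob_field_max_le: "\<P>(\<omega> in M. field_max \<xi> A \<omega> \<le> ereal x) = prob (below x A)"
  by (rule arg_cong[where f = prob]) (auto simp: field_max_le_iff below_def field_max_def SUP_le_iff)

text \<open>Differences are considered because the end of a cluster is such an event: an exceedance
  at a site and none at its later neighbours. The choice \<open>A = {}\<close> covers ordinary
  exceedance. The sets may be infinite, since the lattice is countable.\<close>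

lemma prob_below_diff_translate:
  "prob (below x ((+) h ` A) - below x ((+) h ` B)) = prob (below x A - below x B)"
proof -
  define E where "E = {w \<in> space (PiM UNIV (\<lambda>_. borel)). (\<forall>v\<in>A. w v \<le> x) \<and> \<not> (\<forall>v\<in>B. w v \<le> (x::real))}"
  have E: "E \<in> sets (PiM UNIV (\<lambda>_. borel))"
    unfolding E_def by measurable
  have m: "(\<lambda>\<omega> v. \<xi> (v + h) \<omega>) \<in> measurable M (PiM UNIV (\<lambda>_. borel))" for h
    by (intro measurable_PiM_single') auto
  have "distr M (PiM UNIV (\<lambda>_. borel)) (\<lambda>\<omega> v. \<xi> (v + h) \<omega>) = distr M (PiM UNIV (\<lambda>_. borel)) (\<lambda>\<omega> v. \<xi> v \<omega>)"
    using stationary by (simp add: stationary_field_def)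
  then have "measure (distr M (PiM UNIV (\<lambda>_. borel)) (\<lambda>\<omega> v. \<xi> (v + h) \<omega>)) E
      = measure (distr M (PiM UNIV (\<lambda>_. borel)) (\<lambda>\<omega> v. \<xi> v \<omega>)) E"
    by simp
  then have "prob ((\<lambda>\<omega> v. \<xi> (v + h) \<omega>) -` E \<inter> space M) = prob ((\<lambda>\<omega> v. \<xi> v \<omega>) -` E \<inter> space M)"
    using m[of h] m[of 0] E by (simp add: measure_distr)
  moreover have "(\<lambda>\<omega> v. \<xi> (v + h) \<omega>) -` E \<inter> space M = below x ((+) h ` A) - below x ((+) h ` B)"
    by (auto simp: E_def below_def space_PiM add.commute)
  moreover have "(\<lambda>\<omega> v. \<xi> v \<omega>) -` E \<inter> space M = below x A - below x B"
    by (auto simp: E_def below_def space_PiM)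
  ultimately show ?thesis by simp
qed

lemma prob_below_translate: "prob (below x ((+) h ` A)) = prob (below x A)"
proof -
  have "prob (space M - below x ((+) h ` A)) = prob (space M - below x A)"
    using prob_below_diff_translate[of x h "{}" A] by simp
  then show ?thesis by (simp add: prob_compl)
qed

lemma prob_exceed_le:
  assumes "finite A"
  shows "prob (space M - below x A) \<le> card A * prob (space M - below x {0})"
proof -
  have "space M - below x A = (\<Union>v\<in>A. space M - below x {v})"
    by (auto simp: below_def)
  then have "prob (space M - below x A) \<le> (\<Sum>v\<in>A. prob (space M - below x {v}))"
    using assms finite_measure_subadditive_finite[of A "\<lambda>v. space M - below x {v}"]
    by (auto simp: image_subset_iff sets.Diff)
  also have "\<dots> = (\<Sum>v\<in>A. prob (space M - below x {0}))"
  proof (rule sum.cong[OF refl])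
    fix v
    show "prob (space M - below x {v}) = prob (space M - below x {0})"
      using prob_below_translate[of x v "{0}"] by (simp add: prob_compl)
  qed
  finally show ?thesis by simp
qed

text \<open>Condition D at a single n, with the box always in the first place: this is the role of
  the trimmed box that is split off.\<close>

definition mixing_bound :: "real \<Rightarrow> (int ^ 'd) set \<Rightarrow> real ^ 'd \<Rightarrow> real \<Rightarrow> bool" where
  "mixing_bound x K \<gamma> a \<longleftrightarrow>
     (\<forall>A B. A \<subseteq> K \<and> B \<subseteq> K \<and> separated \<gamma> A B \<and> is_box A \<longrightarrow>
        \<bar>prob (below x (A \<union> B)) - prob (below x A) * prob (below x B)\<bar> \<le> a)"

lemma mixing_bound_trimmed_box:
  assumes "mixing_bound x K \<gamma> a" and "\<And>i. \<bar>\<gamma> $ i\<bar> \<le> of_int (g $ i)" and "trimmed_box t g z \<subseteq> K"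
    and "B \<subseteq> K" and "B \<inter> trimmed_box t 0 z = {}"
  shows "\<bar>prob (below x (trimmed_box t g z \<union> B)) - prob (below x (trimmed_box t g 0)) * prob (below x B)\<bar> \<le> a"
proof -
  have "prob (below x (trimmed_box t g z)) = prob (below x (trimmed_box t g 0))"
    by (subst trimmed_box_translate) (rule prob_below_translate)
  then show ?thesis
    using assms separated_trimmed_box[OF assms(2,5)] is_box_trimmed_box[of t g z]
    unfolding mixing_bound_def by metis
qed

text \<open>One trimmed box is split off at a time. The remaining ones avoid the whole full box
  around it, so they are separated from it and the split costs \<open>a\<close>. Earlier errors do
  not grow, being multiplied by a probability.\<close>

lemma mixing_boxes:
  assumes mix: "mixing_bound x K \<gamma> a" and g: "\<And>i. \<bar>\<gamma> $ i\<bar> \<le> of_int (g $ i)" and t: "\<And>i. 0 < t $ i"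
    and "finite S" and "\<And>z. z \<in> S \<Longrightarrow> trimmed_box t 0 z \<subseteq> K"
  shows "\<bar>prob (below x (\<Union>z\<in>S. trimmed_box t g z)) - prob (below x (trimmed_box t g 0)) ^ card S\<bar> \<le> real (card S) * a"
  using assms(4,5)
proof (induction S rule: finite_induct)
  case empty
  then show ?case by (simp add: prob_space)
next
  case (insert z S)
  let ?B = "\<Union>z\<in>S. trimmed_box t g z" and ?q = "prob (below x (trimmed_box t g 0))"
  have g0: "0 \<le> g $ i" for i using g[of i] by linarith
  have sub: "trimmed_box t g z \<subseteq> trimmed_box t 0 z" for z
    by (rule trimmed_box_mono) (rule g0)
  have "?B \<inter> trimmed_box t 0 z = {}"
    using sub disjoint_boxes[of t _ z] t insert.hyps(2) by fast
  then have "\<bar>prob (below x (trimmed_box t g z \<union> ?B)) - ?q * prob (below x ?B)\<bar> \<le> a"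
    using insert.prems sub by (intro mixing_bound_trimmed_box[OF mix g]) blast+
  moreover have "\<bar>?q * prob (below x ?B) - ?q * ?q ^ card S\<bar> \<le> real (card S) * a"
  proof -
    have "\<bar>?q * (prob (below x ?B) - ?q ^ card S)\<bar> \<le> 1 * (real (card S) * a)"
      unfolding abs_mult using insert.IH insert.prems by (intro mult_mono) auto
    then show ?thesis by (simp add: algebra_simps)
  qed
  ultimately show ?case
    using insert.hyps by (simp add: algebra_simps abs_le_iff)
qed

text \<open>
  The product is the conditional probability of avoiding \<open>V z\<close> for every \<open>z\<close> in a random subset
  of \<open>Z\<close> that contains each \<open>z\<close> independently with probability \<open>h z\<close>. Averaging over this subset, a
  bound on avoidance probabilities becomes a bound on the Laplace functional.
\<close>

lemma expectation_thinned_product: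
  assumes "finite Z" and h: "\<And>z. z \<in> Z \<Longrightarrow> 0 \<le> h z \<and> h z \<le> 1" and "0 \<le> a"
    and V [measurable]: "\<And>z. V z \<in> events"
    and avoid: "\<And>S. S \<subseteq> Z \<Longrightarrow> \<bar>prob {\<omega>\<in>space M. \<forall>z\<in>S. \<omega> \<notin> V z} - q ^ card S\<bar> \<le> real (card S) * a"
  shows "\<bar>(\<integral>\<omega>. (\<Prod>z\<in>Z. 1 - h z * indicator (V z) \<omega>) \<partial>M) - (\<Prod>z\<in>Z. 1 - h z * (1 - q))\<bar> \<le> real (card Z) * a"
proof -
  \<comment> \<open>\<open>w S\<close> is the probability that the random subset of \<open>Z\<close>
    equals \<open>S\<close>.\<close>
  define w where "w S = (\<Prod>z\<in>S. h z) * (\<Prod>z\<in>Z - S. 1 - h z)" for S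
  let ?E = "\<lambda>S. {\<omega>\<in>space M. \<forall>z\<in>S. \<omega> \<notin> V z}"
  have w0: "0 \<le> w S" if "S \<in> Pow Z" for S
    using h that unfolding w_def by (intro mult_nonneg_nonneg prod_nonneg) auto
  have w1: "(\<Sum>S\<in>Pow Z. w S) = 1"
    using prod_add[OF \<open>finite Z\<close>, of h "\<lambda>z. 1 - h z"] by (simp add: w_def)
  have fin: "finite S" if "S \<in> Pow Z" for S using that \<open>finite Z\<close> finite_subset by auto
  have E [measurable]: "?E S \<in> events" if "S \<in> Pow Z" for S
    using fin[OF that] by measurable
  have "(\<Prod>z\<in>Z. 1 - h z * indicator (V z) \<omega>) = (\<Sum>S\<in>Pow Z. w S * indicator (?E S) \<omega>)"
    if "\<omega> \<in> space M" for \<omega>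
  proof -
    \<comment> \<open>Each factor splits into \<open>h z\<close> times the indicator of avoidance
      plus \<open>1 - h z\<close>. Expanding the product over the chosen summands produces the
      subsets; the deterministic product below is expanded in the same way with q in place of the
      indicator.\<close>
    have "(\<Prod>z\<in>Z. 1 - h z * indicator (V z) \<omega>) = (\<Prod>z\<in>Z. h z * (1 - indicator (V z) \<omega>) + (1 - h z))"
      by (intro prod.cong) (auto simp: algebra_simps)
    also have "\<dots> = (\<Sum>S\<in>Pow Z. (\<Prod>z\<in>S. h z * (1 - indicator (V z) \<omega>)) * (\<Prod>z\<in>Z - S. 1 - h z))"
      by (rule prod_add) fact
    also have "\<dots> = (\<Sum>S\<in>Pow Z. w S * indicator (?E S) \<omega>)"
    proof (rule sum.cong[OF refl])
      fix S assume S: "S \<in> Pow Z"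
      have "(\<Prod>z\<in>S. 1 - indicator (V z) \<omega>) = (indicator (?E S) \<omega> :: real)"
        using fin[OF S] that by (auto simp: indicator_def intro!: prod.neutral)
      then show "(\<Prod>z\<in>S. h z * (1 - indicator (V z) \<omega>)) * (\<Prod>z\<in>Z - S. 1 - h z) = w S * indicator (?E S) \<omega>"
        by (simp add: prod.distrib w_def)
    qed
    finally show ?thesis .
  qed
  then have "(\<integral>\<omega>. (\<Prod>z\<in>Z. 1 - h z * indicator (V z) \<omega>) \<partial>M) = (\<integral>\<omega>. (\<Sum>S\<in>Pow Z. w S * indicator (?E S) \<omega>) \<partial>M)"
    by (intro Bochner_Integration.integral_cong) auto
  also have "\<dots> = (\<Sum>S\<in>Pow Z. w S * prob (?E S))"
    using E by (subst Bochner_Integration.integral_sum) (auto simp: integrable_indicator_iff emeasure_eq_measure)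
  finally have 1: "(\<integral>\<omega>. (\<Prod>z\<in>Z. 1 - h z * indicator (V z) \<omega>) \<partial>M) = (\<Sum>S\<in>Pow Z. w S * prob (?E S))" .
  have "(\<Prod>z\<in>Z. 1 - h z * (1 - q)) = (\<Prod>z\<in>Z. h z * q + (1 - h z))"
    by (intro prod.cong) (auto simp: algebra_simps)
  also have "\<dots> = (\<Sum>S\<in>Pow Z. (\<Prod>z\<in>S. h z * q) * (\<Prod>z\<in>Z - S. 1 - h z))"
    by (rule prod_add) fact
  also have "\<dots> = (\<Sum>S\<in>Pow Z. w S * q ^ card S)"
    by (simp add: w_def prod.distrib mult_ac)
  finally have "(\<integral>\<omega>. (\<Prod>z\<in>Z. 1 - h z * indicator (V z) \<omega>) \<partial>M) - (\<Prod>z\<in>Z. 1 - h z * (1 - q))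
      = (\<Sum>S\<in>Pow Z. w S * (prob (?E S) - q ^ card S))"
    by (simp add: 1 sum_subtractf algebra_simps)
  also have "\<bar>\<dots>\<bar> \<le> (\<Sum>S\<in>Pow Z. w S * (real (card Z) * a))"
  proof (rule sum_abs[THEN order_trans], rule sum_mono)
    fix S assume S: "S \<in> Pow Z"
    have "\<bar>prob (?E S) - q ^ card S\<bar> \<le> real (card S) * a"
      using S avoid by blast
    also have "\<dots> \<le> real (card Z) * a"
      using S \<open>finite Z\<close> \<open>0 \<le> a\<close> by (intro mult_right_mono) (auto intro: card_mono)
    finally show "\<bar>w S * (prob (?E S) - q ^ card S)\<bar> \<le> w S * (real (card Z) * a)"
      using w0[OF S] by (simp add: abs_mult mult_left_mono)
  qed
  also have "\<dots> = real (card Z) * a"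
    using w1 by (simp flip: sum_distrib_right)
  finally show ?thesis .
qed

lemma laplace_trimmed_boxes:
  assumes mix: "mixing_bound x K \<gamma> a" and g: "\<And>i. \<bar>\<gamma> $ i\<bar> \<le> of_int (g $ i)" and t: "\<And>i. 0 < t $ i"
    and "finite Z" and sub: "\<And>z. z \<in> Z \<Longrightarrow> trimmed_box t 0 z \<subseteq> K" and "0 \<le> a"
    and h: "\<And>z. z \<in> Z \<Longrightarrow> 0 \<le> h z \<and> h z \<le> 1"
  shows "\<bar>(\<integral>\<omega>. (\<Prod>z\<in>Z. 1 - h z * indicator (space M - below x (trimmed_box t g z)) \<omega>) \<partial>M)
      - (\<Prod>z\<in>Z. 1 - h z * prob (space M - below x (trimmed_box t g 0)))\<bar> \<le> real (card Z) * a"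
proof -
  have "\<bar>(\<integral>\<omega>. (\<Prod>z\<in>Z. 1 - h z * indicator (space M - below x (trimmed_box t g z)) \<omega>) \<partial>M)
      - (\<Prod>z\<in>Z. 1 - h z * (1 - prob (below x (trimmed_box t g 0))))\<bar> \<le> real (card Z) * a"
  proof (rule expectation_thinned_product[OF \<open>finite Z\<close> h \<open>0 \<le> a\<close>])
    fix S assume "S \<subseteq> Z"
    then have "finite S" using \<open>finite Z\<close> finite_subset by blast
    have "{\<omega>\<in>space M. \<forall>z\<in>S. \<omega> \<notin> space M - below x (trimmed_box t g z)} = below x (\<Union>z\<in>S. trimmed_box t g z)"
      by (auto simp: below_UN)
    then show "\<bar>prob {\<omega>\<in>space M. \<forall>z\<in>S. \<omega> \<notin> space M - below x (trimmed_box t g z)}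
        - prob (below x (trimmed_box t g 0)) ^ card S\<bar> \<le> real (card S) * a"
      using mixing_boxes[OF mix g t \<open>finite S\<close>] sub \<open>S \<subseteq> Z\<close> by auto
  qed auto
  then show ?thesis by (simp add: prob_compl)
qed

text \<open>An exceedance in the full box but not in the trimmed one lies in the removed shell, and
  a union bound over the shell applies.\<close>

lemma prob_exceed_trim_le:
  assumes "\<And>i. 0 \<le> g $ i"
  shows "prob (below x (trimmed_box t g z) - below x (trimmed_box t 0 z))
    \<le> real (card (trimmed_box t 0 0) - card (trimmed_box t g 0)) * prob (space M - below x {0})"
proof -
  have sub: "trimmed_box t g z \<subseteq> trimmed_box t 0 z"
    by (rule trimmed_box_mono) fact
  have "prob (below x (trimmed_box t g z) - below x (trimmed_box t 0 z))
      \<le> prob (space M - below x (trimmed_box t 0 z - trimmed_box t g z))"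
    by (rule finite_measure_mono) (auto simp: below_def)
  also have "\<dots> \<le> real (card (trimmed_box t 0 z - trimmed_box t g z)) * prob (space M - below x {0})"
    by (rule prob_exceed_le) (simp add: finite_trimmed_box)
  also have "card (trimmed_box t 0 z - trimmed_box t g z) = card (trimmed_box t 0 0) - card (trimmed_box t g 0)"
    using sub by (simp add: card_Diff_subset finite_trimmed_box card_trimmed_box)
  finally show ?thesis .
qed

text \<open>Full and trimmed boxes give products in [0, 1] that differ only if some shell contains
  an exceedance. The error is thus the probability of this event plus the mixing error. The
  deterministic product keeps the trimmed boxes.\<close>

lemma laplace_boxes:
  assumes mix: "mixing_bound x K \<gamma> a" and g: "\<And>i. \<bar>\<gamma> $ i\<bar> \<le> of_int (g $ i)" and t: "\<And>i. 0 < t $ i"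
    and "finite Z" and sub: "\<And>z. z \<in> Z \<Longrightarrow> trimmed_box t 0 z \<subseteq> K" and "0 \<le> a"
    and h: "\<And>z. z \<in> Z \<Longrightarrow> 0 \<le> h z \<and> h z \<le> 1"
  shows "\<bar>(\<integral>\<omega>. (\<Prod>z\<in>Z. 1 - h z * indicator (space M - below x (trimmed_box t 0 z)) \<omega>) \<partial>M)
      - (\<Prod>z\<in>Z. 1 - h z * prob (space M - below x (trimmed_box t g 0)))\<bar>
    \<le> real (card Z) * (a + real (card (trimmed_box t 0 0) - card (trimmed_box t g 0)) * prob (space M - below x {0}))"
proof -
  let ?F = "\<lambda>g \<omega>. \<Prod>z\<in>Z. 1 - h z * indicator (space M - below x (trimmed_box t g z)) \<omega>"
  let ?D = "\<Union>z\<in>Z. below x (trimmed_box t g z) - below x (trimmed_box t 0 z)"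
  have g0: "0 \<le> g $ i" for i using g[of i] by linarith
  have sb: "below x (trimmed_box t 0 z) \<subseteq> below x (trimmed_box t g z)" for z
    by (intro below_mono trimmed_box_mono g0)
  have F01: "0 \<le> ?F g \<omega>" "?F g \<omega> \<le> 1" for g \<omega>
    using h by (auto intro!: prod_nonneg prod_le_1 simp: indicator_def)
  have D [measurable]: "?D \<in> events"
    using \<open>finite Z\<close> by (intro sets.finite_UN) auto
  have int: "integrable M (?F g)" for g
    using F01 by (intro integrable_const_bound[of _ 1]) auto
  have diff: "\<bar>?F 0 \<omega> - ?F g \<omega>\<bar> \<le> indicator ?D \<omega>" for \<omega>
  proof (cases "\<omega> \<in> ?D")
    case True
    then show ?thesis using F01[of 0 \<omega>] F01[of g \<omega>] by (simp only: indicator_simps)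
  next
    case False
    then have "?F 0 \<omega> = ?F g \<omega>"
      using sb by (intro prod.cong) (auto simp: indicator_def)
    then show ?thesis by simp
  qed
  have "\<bar>(\<integral>\<omega>. ?F 0 \<omega> \<partial>M) - (\<integral>\<omega>. ?F g \<omega> \<partial>M)\<bar> = \<bar>\<integral>\<omega>. ?F 0 \<omega> - ?F g \<omega> \<partial>M\<bar>"
    using int by simp
  also have "\<dots> \<le> (\<integral>\<omega>. indicator ?D \<omega> \<partial>M)"
  proof (intro integral_abs_bound[THEN order_trans] integral_mono)
    show "integrable M (\<lambda>\<omega>. \<bar>?F 0 \<omega> - ?F g \<omega>\<bar>)"
      using int by (intro integrable_abs Bochner_Integration.integrable_diff)
    show "integrable M (indicator ?D :: _ \<Rightarrow> real)"
      using D by (intro integrable_real_indicator) (auto simp: emeasure_eq_measure)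
  qed (rule diff)
  also have "\<dots> = prob ?D" using D by simp
  also have "\<dots> \<le> (\<Sum>z\<in>Z. prob (below x (trimmed_box t g z) - below x (trimmed_box t 0 z)))"
    using \<open>finite Z\<close> by (intro finite_measure_subadditive_finite) auto
  also have "\<dots> \<le> (\<Sum>z\<in>Z. real (card (trimmed_box t 0 0) - card (trimmed_box t g 0)) * prob (space M - below x {0}))"
    by (intro sum_mono prob_exceed_trim_le g0)
  finally have "\<bar>(\<integral>\<omega>. ?F 0 \<omega> \<partial>M) - (\<integral>\<omega>. ?F g \<omega> \<partial>M)\<bar>
      \<le> real (card Z) * (real (card (trimmed_box t 0 0) - card (trimmed_box t g 0)) * prob (space M - below x {0}))"
    by simp
  moreover have "\<bar>(\<integral>\<omega>. ?F g \<omega> \<partial>M) - (\<Prod>z\<in>Z. 1 - h z * prob (space M - below x (trimmed_box t g 0)))\<bar> \<le> real (card Z) * a"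
    by (rule laplace_trimmed_boxes[OF mix g t \<open>finite Z\<close> sub \<open>0 \<le> a\<close> h])
  ultimately show ?thesis
    unfolding distrib_left by linarith
qed

section \<open>Clusters, their last exceedances, and exceedances in neighbouring boxes\<close>

lemma prob_cluster_end_translate:
  "prob (below x ((+) v ` later_neighbours r t) - below x {v})
    = prob (below x (later_neighbours r t) - below x {0})"
  using prob_below_diff_translate[of x v "later_neighbours r t" "{0}"] by simp

text \<open>
  A box containing exceedances has a last one. It is counted by the event that an exceedance at \<open>v\<close>
  is not followed by another one in its whole neighbourhood, unless a further exceedance occurs
  outside the box.
\<close>

lemma prob_exceed_box_bounds:
  fixes x :: real
  assumes r: "translation_invariant_order r" and t: "\<And>i. 0 < t $ i"
  defines "J \<equiv> trimmed_box t 0 0" and "u \<equiv> prob (below x (later_neighbours r t) - below x {0})"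
    and "L \<equiv> {v. \<forall>i. v $ i \<in> {- t $ i..<2 * t $ i}}"
  shows "real (card J) * u \<le> prob (space M - below x J)" (is ?lower)
    and "prob (space M - below x J) \<le> real (card J) * u + prob ((space M - below x J) - below x (L - J))" (is ?upper)
proof -
  define E where "E v = below x ((+) v ` later_neighbours r t) - below x {v}" for v
  have [measurable]: "E v \<in> events" for v unfolding E_def by measurable
  have fin: "finite J" unfolding J_def by (rule finite_trimmed_box)
  have lin: "linear_order r" using r by (simp add: translation_invariant_order_def)
  have later: "z \<in> (+) v ` later_neighbours r t \<longleftrightarrow> (v, z) \<in> r \<and> z \<noteq> v \<and> (\<forall>i. \<bar>z $ i - v $ i\<bar> \<le> t $ i)" for v z
  proof -
    have "z \<in> (+) v ` later_neighbours r t \<longleftrightarrow> z - v \<in> later_neighbours r t"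
      by (metis (no_types, lifting) add_diff_cancel_left' diff_add_cancel add.commute image_iff)
    then show ?thesis
      using translation_invariant_order_iff[OF r, of 0 v "z - v"] by (simp add: later_neighbours_def)
  qed
  have J: "v \<in> J \<longleftrightarrow> (\<forall>i. 0 \<le> v $ i \<and> v $ i < t $ i)" for v
    by (simp add: J_def trimmed_box_def)
  have near: "\<bar>z $ i - v $ i\<bar> \<le> t $ i" if "v \<in> J" "z \<in> J" for v z i
    using that unfolding J by (smt (verit))
  have disj: "disjoint_family_on E J"
    unfolding disjoint_family_on_def
  proof (intro ballI impI)
    \<comment> \<open>Two sites of one box differ by at most \<open>t\<close> in each coordinate. If
      v precedes z, then z is a later neighbour of v, so \<open>E v\<close> forbids the exceedance
      at z that \<open>E z\<close> requires.\<close>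
    have *: "E v \<inter> E z = {}" if "v \<in> J" "z \<in> J" "v \<noteq> z" "(v, z) \<in> r" for v z
    proof -
      have "z \<in> (+) v ` later_neighbours r t"
        using that near by (simp add: later)
      then show ?thesis unfolding E_def below_def by blast
    qed
    fix v z assume "v \<in> J" "z \<in> J" "v \<noteq> z"
    moreover then have "(v, z) \<in> r \<or> (z, v) \<in> r"
      using lin by (auto simp: order_on_defs total_on_def)
    ultimately show "E v \<inter> E z = {}" using *[of v z] *[of z v] by blast
  qed
  have "prob (\<Union>v\<in>J. E v) = (\<Sum>v\<in>J. prob (E v))"
    using fin disj by (intro finite_measure_finite_Union) auto
  also have "\<dots> = real (card J) * u"
    unfolding E_def prob_cluster_end_translate u_def by simp
  finally have union: "prob (\<Union>v\<in>J. E v) = real (card J) * u" .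
  have "(\<Union>v\<in>J. E v) \<subseteq> space M - below x J"
    by (auto simp: E_def below_def)
  then show ?lower
    unfolding union[symmetric] by (intro finite_measure_mono) auto
  have "space M - below x J \<subseteq> (\<Union>v\<in>J. E v) \<union> ((space M - below x J) - below x (L - J))"
  proof (rule subsetI, rule UnCI)
    fix \<omega> assume \<omega>: "\<omega> \<in> space M - below x J" "\<omega> \<notin> (space M - below x J) - below x (L - J)"
    then have L: "\<And>v. v \<in> L - J \<Longrightarrow> \<xi> v \<omega> \<le> x" by (auto simp: below_def)
    \<comment> \<open>The last exceedance in the box is a witness: a later exceedance in its
      neighbourhood would lie either in \<open>J\<close>, against maximality, or in
      \<open>L - J\<close>, which is excluded here.\<close>
    let ?X = "{v\<in>J. x < \<xi> v \<omega>}"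
    have "finite ?X" "?X \<noteq> {}" using fin \<omega> by (auto simp: below_def not_le)
    then obtain v where v: "v \<in> ?X" and max: "\<And>z. z \<in> ?X \<Longrightarrow> (z, v) \<in> r"
      by (rule linear_order_finite_greatest[OF lin]) auto
    have "\<xi> z \<omega> \<le> x" if z: "z \<in> (+) v ` later_neighbours r t" for z
    proof (rule ccontr)
      assume "\<not> \<xi> z \<omega> \<le> x"
      moreover have "z \<in> J"
      proof (rule ccontr)
        assume "z \<notin> J"
        \<comment> \<open>From 0 <= v < t and |z - v| <= t in every coordinate one gets -t <= z < 2
          t, the block of the box with its adjacent boxes.\<close>
        have "z \<in> L"
          unfolding L_def
        proof clarify
          fix i
          have "0 \<le> v $ i \<and> v $ i < t $ i" "\<bar>z $ i - v $ i\<bar> \<le> t $ i"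
            using v z unfolding later J by auto
          then show "z $ i \<in> {- t $ i..<2 * t $ i}" by auto
        qed
        then show False using L \<open>z \<notin> J\<close> \<open>\<not> \<xi> z \<omega> \<le> x\<close> by blast
      qed
      ultimately have "(z, v) \<in> r" using max by simp
      moreover have "(v, z) \<in> r" "z \<noteq> v" using z by (auto simp: later)
      ultimately show False
        using lin by (auto simp: order_on_defs antisym_def)
    qed
    then have "\<omega> \<in> E v" using v \<omega> by (auto simp: E_def below_def)
    then show "\<omega> \<in> (\<Union>v\<in>J. E v)" using v by blast
  qed
  then have "prob (space M - below x J) \<le> prob ((\<Union>v\<in>J. E v) \<union> ((space M - below x J) - below x (L - J)))"
    using fin by (intro finite_measure_mono) auto
  also have "\<dots> \<le> prob (\<Union>v\<in>J. E v) + prob ((space M - below x J) - below x (L - J))"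
    using fin by (intro measure_Un_le) auto
  finally show ?upper unfolding union .
qed

text \<open>The shell separates \<open>J'\<close> from \<open>L - J\<close>, so exceedances in both
  are nearly independent and union bounds estimate the two factors. Passing from \<open>J\<close> to
  \<open>J'\<close> costs an exceedance in the shell.\<close>

lemma prob_two_exceedances_le:
  fixes x :: real
  assumes mix: "mixing_bound x K \<gamma> a" and g: "\<And>i. \<bar>\<gamma> $ i\<bar> \<le> of_int (g $ i)" and t: "\<And>i. 0 < t $ i"
  defines "J \<equiv> trimmed_box t 0 0" and "J' \<equiv> trimmed_box t g 0" and "\<pi> \<equiv> prob (space M - below x {0})"
  assumes "finite L" and L: "L \<subseteq> K" and J: "J \<subseteq> L"
  shows "prob ((space M - below x J) - below x (L - J))
    \<le> real (card J - card J') * \<pi> + (real (card J) * \<pi>) * (real (card L) * \<pi>) + a"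
proof -
  let ?B = "L - J"
  have g0: "0 \<le> g $ i" for i using g[of i] by linarith
  have sub: "J' \<subseteq> J" unfolding J_def J'_def by (rule trimmed_box_mono) (rule g0)
  have fin: "finite J" "finite J'" by (auto simp: J_def J'_def finite_trimmed_box)
  have "\<bar>prob (below x (J' \<union> ?B)) - prob (below x J') * prob (below x ?B)\<bar> \<le> a"
    unfolding J'_def using sub L J by (intro mixing_bound_trimmed_box[OF mix g]) (auto simp: J_def J'_def)
  \<comment> \<open>Inclusion-exclusion carries the mixing bound from joint avoidance to joint
    exceedance with the same error.\<close>
  moreover have "prob ((space M - below x J') - below x ?B)
      = 1 - prob (below x J') - prob (below x ?B) + prob (below x (J' \<union> ?B))"
  proof -
    have "(space M - below x J') - below x ?B = space M - (below x J' \<union> below x ?B)"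
      by auto
    moreover have "prob (below x J' \<union> below x ?B) = prob (below x J') + prob (below x ?B) - prob (below x (J' \<union> ?B))"
      by (subst measure_Un3) (auto simp: fmeasurable_eq_sets below_Un)
    ultimately show ?thesis by (simp add: prob_compl)
  qed
  ultimately have "prob ((space M - below x J') - below x ?B)
      \<le> prob (space M - below x J') * prob (space M - below x ?B) + a"
    by (simp add: prob_compl algebra_simps abs_le_iff)
  also have "prob (space M - below x J') * prob (space M - below x ?B) \<le> (real (card J) * \<pi>) * (real (card L) * \<pi>)"
  proof (intro mult_mono)
    have "prob (space M - below x J') \<le> real (card J') * \<pi>"
      unfolding \<pi>_def using fin by (intro prob_exceed_le)
    also have "\<dots> \<le> real (card J) * \<pi>"
      using fin sub by (intro mult_right_mono) (auto simp: \<pi>_def card_mono)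
    finally show "prob (space M - below x J') \<le> real (card J) * \<pi>" .
    have "prob (space M - below x ?B) \<le> real (card ?B) * \<pi>"
      unfolding \<pi>_def using \<open>finite L\<close> by (intro prob_exceed_le) auto
    also have "\<dots> \<le> real (card L) * \<pi>"
      using \<open>finite L\<close> by (intro mult_right_mono) (auto simp: \<pi>_def card_mono)
    finally show "prob (space M - below x ?B) \<le> real (card L) * \<pi>" .
  qed (auto simp: \<pi>_def)
  finally have "prob ((space M - below x J') - below x ?B) \<le> (real (card J) * \<pi>) * (real (card L) * \<pi>) + a"
    by simp
  moreover have "prob ((space M - below x J) - below x ?B)
      \<le> prob ((space M - below x J') - below x ?B) + prob (below x J' - below x J)"
    by (intro order_trans[OF finite_measure_mono measure_Un_le]) auto
  moreover have "prob (below x J' - below x J) \<le> real (card J - card J') * \<pi>"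
    unfolding J_def J'_def \<pi>_def by (rule prob_exceed_trim_le) (rule g0)
  ultimately show ?thesis by simp
qed

end

section \<open>Asymptotics\<close>

locale clustered_field = stationary_random_field M \<xi> for M :: "'a measure" and \<xi> :: "int ^ 'd \<Rightarrow> 'a \<Rightarrow> real" +
  fixes C :: "(real ^ 'd) set"
    and p :: nat
    and c :: "nat \<Rightarrow> real ^ 'd"
    and \<kappa> :: real
    and x :: "nat \<Rightarrow> real"
    and \<gamma> :: "nat \<Rightarrow> real ^ 'd"
    and \<alpha> :: "nat \<Rightarrow> real"
    and k :: "nat \<Rightarrow> nat"
    and r :: "(int ^ 'd) rel"
    and \<theta> \<tau> :: real
  assumes C: "p_convex p C" and vol_C: "emeasure lborel C = 1"
    and c_pos: "\<And>n i. 0 < c n $ i"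
    and c_lim: "\<And>i. filterlim (\<lambda>n. c n $ i) at_top sequentially"
    and k_pos: "\<And>n. 0 < k n" and k_lim: "filterlim k at_top sequentially"
    and root_k: "vec_smallo (\<lambda>n. \<chi> i. root CARD('d) (real (k n))) c"
    and \<kappa>_pos: "0 < \<kappa>" and D_plus_sub: "\<And>n. D_plus (c n) (k n) C \<subseteq> K_set \<kappa> (c n)"
    and D: "condition_D M \<xi> x (\<lambda>n. K_set \<kappa> (c n)) c \<gamma> \<alpha>"
    and k_\<alpha>: "(\<lambda>n. real (k n) * \<alpha> n) \<longlonglongrightarrow> 0"
    and root_\<gamma>: "vec_smallo (\<lambda>n. root CARD('d) (real (k n)) *\<^sub>R \<gamma> n) c"
    and r: "translation_invariant_order r"
    and Dl: "condition_Dl M \<xi> r c x k \<theta>"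
    and intensity: "(\<lambda>n. real (card (lattice_points ((*) (c n) ` C))) * \<P>(\<omega> in M. \<xi> 0 \<omega> > x n)) \<longlonglongrightarrow> \<tau>"
begin

section \<open>Asymptotic sizes of boxes and shells\<close>

definition t :: "nat \<Rightarrow> int ^ 'd" where
  "t n = (\<chi> i. \<lfloor>c n $ i / root CARD('d) (real (k n))\<rfloor>)"

text \<open>The smallest integer width that covers the mixing range. Rounding adds less than 1 per
  coordinate, which is negligible because the box sides tend to infinity.\<close>

definition g :: "nat \<Rightarrow> int ^ 'd" where
  "g n = (\<chi> i. \<lceil>\<bar>\<gamma> n $ i\<bar>\<rceil>)"

abbreviation s :: "nat \<Rightarrow> real ^ 'd" where
  "s n \<equiv> cell_side (c n) (k n)"

abbreviation J :: "nat \<Rightarrow> (int ^ 'd) set" where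
  "J n \<equiv> trimmed_box (t n) 0 0"

abbreviation J' :: "nat \<Rightarrow> (int ^ 'd) set" where
  "J' n \<equiv> trimmed_box (t n) (g n) 0"

definition \<pi> :: "nat \<Rightarrow> real" where
  "\<pi> n = prob (space M - below (x n) {0})"

lemma \<gamma>_le_g: "\<bar>\<gamma> n $ i\<bar> \<le> of_int (g n $ i)"
  by (simp add: g_def)

lemma root_k_pos: "0 < root CARD('d) (real (k n))"
  using k_pos by simp

lemma root_k_power: "root CARD('d) (real (k n)) ^ CARD('d) = real (k n)"
  by (rule real_root_pow_pos2) auto

lemma box_side_t: "box_side (c n) (k n) = of_lattice (t n)"
  by (simp add: box_side_def of_lattice_def t_def vec_eq_iff)

lemma s_eq: "s n $ i = of_int (t n $ i) / c n $ i"
  by (simp add: cell_side_def box_side_t of_lattice_def)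

lemma k_real_lim: "filterlim (\<lambda>n. real (k n)) at_top sequentially"
  using filterlim_compose[OF filterlim_real_sequentially k_lim] .

lemma root_k_lim: "filterlim (\<lambda>n. root CARD('d) (real (k n))) at_top sequentially"
  unfolding filterlim_at_top
proof
  fix Z :: real
  have "eventually (\<lambda>n. max Z 0 ^ CARD('d) \<le> real (k n)) sequentially"
    using k_real_lim by (simp add: filterlim_at_top)
  then show "eventually (\<lambda>n. Z \<le> root CARD('d) (real (k n))) sequentially"
  proof eventually_elim
    case (elim n)
    then have "root CARD('d) (max Z 0 ^ CARD('d)) \<le> root CARD('d) (real (k n))"
      by (intro real_root_le_mono) auto
    moreover have "root CARD('d) (max Z 0 ^ CARD('d)) = max Z 0"
      by (intro real_root_power_cancel) auto
    ultimately show ?case by simp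
  qed
qed

lemma length_lim: "filterlim (\<lambda>n. c n $ i / root CARD('d) (real (k n))) at_top sequentially"
proof -
  have "(\<lambda>n. root CARD('d) (real (k n)) / c n $ i) \<longlonglongrightarrow> 0"
    using root_k by (simp add: vec_smallo_def)
  moreover have "eventually (\<lambda>n. 0 < root CARD('d) (real (k n)) / c n $ i) sequentially"
    using root_k_pos c_pos by (intro always_eventually) auto
  ultimately have "filterlim (\<lambda>n. inverse (root CARD('d) (real (k n)) / c n $ i)) at_top sequentially"
    by (rule filterlim_inverse_at_top)
  then show ?thesis by simp
qed

lemma t_ratio: "(\<lambda>n. of_int (t n $ i) / (c n $ i / root CARD('d) (real (k n)))) \<longlonglongrightarrow> 1"
  unfolding t_def using tendsto_floor_ratio[OF length_lim] by simp

lemma t_nonneg: "0 \<le> t n $ i"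
  using c_pos[of n i] root_k_pos[of n] by (simp add: t_def)

lemma t_pos_eventually: "eventually (\<lambda>n. \<forall>i. 0 < t n $ i) sequentially"
proof (rule eventually_all_finite)
  fix i
  have "eventually (\<lambda>n. 1 \<le> c n $ i / root CARD('d) (real (k n))) sequentially"
    using length_lim by (simp add: filterlim_at_top)
  then show "eventually (\<lambda>n. 0 < t n $ i) sequentially"
    by eventually_elim (simp add: t_def)
qed

lemma s_pos_eventually: "eventually (\<lambda>n. \<forall>i. 0 < s n $ i) sequentially"
  using t_pos_eventually by eventually_elim (simp add: s_eq c_pos)

lemma s_lim: "s \<longlonglongrightarrow> 0"
proof (rule vec_tendstoI)
  fix i
  have "(\<lambda>n. of_int (t n $ i) / (c n $ i / root CARD('d) (real (k n))) * (1 / root CARD('d) (real (k n)))) \<longlonglongrightarrow> 1 * 0"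
    by (intro tendsto_mult t_ratio tendsto_divide_0[OF tendsto_const] filterlim_at_top_imp_at_infinity root_k_lim)
  moreover have "of_int (t n $ i) / (c n $ i / root CARD('d) (real (k n))) * (1 / root CARD('d) (real (k n))) = s n $ i" for n
    using root_k_pos[of n] by (simp add: s_eq)
  ultimately show "(\<lambda>n. s n $ i) \<longlonglongrightarrow> 0 $ i" by simp
qed

text \<open>The d-th root of k is distributed over the d coordinates; each factor is then the ratio
  of a box side to its value before rounding down.\<close>

lemma k_prod_s: "(\<lambda>n. real (k n) * (\<Prod>i\<in>UNIV. s n $ i)) \<longlonglongrightarrow> 1"
proof -
  have "real (k n) * (\<Prod>i\<in>UNIV. s n $ i) = (\<Prod>i\<in>UNIV. of_int (t n $ i) / (c n $ i / root CARD('d) (real (k n))))" for n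
  proof -
    have "real (k n) = (\<Prod>i\<in>(UNIV::'d set). root CARD('d) (real (k n)))" by (simp only: prod_constant root_k_power)
    then have "real (k n) * (\<Prod>i\<in>UNIV. s n $ i) = (\<Prod>i\<in>UNIV. root CARD('d) (real (k n)) * s n $ i)"
      by (simp only: prod.distrib)
    then show ?thesis by (simp add: s_eq mult.commute)
  qed
  moreover have "(\<lambda>n. \<Prod>i\<in>UNIV. of_int (t n $ i) / (c n $ i / root CARD('d) (real (k n)))) \<longlonglongrightarrow> (\<Prod>i\<in>(UNIV::'d set). 1)"
    by (intro tendsto_prod t_ratio)
  ultimately show ?thesis by simp
qed

lemma card_J: "real (card (J n)) = (\<Prod>i\<in>UNIV. of_int (t n $ i))"
  by (simp add: card_trimmed_box t_nonneg)

text \<open>In units of the box side, the mixing range vanishes by \<open>root_\<gamma>\<close> and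
  the rounding error by \<open>root_k\<close>.\<close>

lemma g_ratio: "(\<lambda>n. real_of_int (g n $ i) / of_int (t n $ i)) \<longlonglongrightarrow> 0"
proof -
  have bound: "norm (of_int (g n $ i) / (c n $ i / root CARD('d) (real (k n))))
      \<le> \<bar>root CARD('d) (real (k n)) * \<gamma> n $ i / c n $ i\<bar> + root CARD('d) (real (k n)) / c n $ i" for n
  proof -
    define u where "u = root CARD('d) (real (k n)) / c n $ i"
    have u: "0 < u" using root_k_pos[of n] c_pos[of n i] by (simp add: u_def)
    have "\<bar>real_of_int (g n $ i)\<bar> \<le> \<bar>\<gamma> n $ i\<bar> + 1" unfolding g_def by simp
    then have "\<bar>real_of_int (g n $ i)\<bar> * u \<le> (\<bar>\<gamma> n $ i\<bar> + 1) * u"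
      using u by (intro mult_right_mono) auto
    moreover have "of_int (g n $ i) / (c n $ i / root CARD('d) (real (k n))) = of_int (g n $ i) * u"
      "root CARD('d) (real (k n)) * \<gamma> n $ i / c n $ i = \<gamma> n $ i * u"
      by (simp_all add: u_def mult.commute)
    ultimately show ?thesis
      using u unfolding u_def[symmetric] by (simp add: abs_mult distrib_right)
  qed
  have "(\<lambda>n. \<bar>root CARD('d) (real (k n)) * \<gamma> n $ i / c n $ i\<bar> + root CARD('d) (real (k n)) / c n $ i) \<longlonglongrightarrow> \<bar>0\<bar> + 0"
    using root_\<gamma> root_k by (intro tendsto_intros) (auto simp: vec_smallo_def)
  then have "(\<lambda>n. \<bar>root CARD('d) (real (k n)) * \<gamma> n $ i / c n $ i\<bar> + root CARD('d) (real (k n)) / c n $ i) \<longlonglongrightarrow> 0"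
    by simp
  then have "(\<lambda>n. of_int (g n $ i) / (c n $ i / root CARD('d) (real (k n)))) \<longlonglongrightarrow> 0"
    by (rule Lim_null_comparison[rotated], intro always_eventually allI bound)
  then have "(\<lambda>n. (of_int (g n $ i) / (c n $ i / root CARD('d) (real (k n)))) / (of_int (t n $ i) / (c n $ i / root CARD('d) (real (k n))))) \<longlonglongrightarrow> 0 / 1"
    by (intro tendsto_divide t_ratio) auto
  moreover have "c n $ i / root CARD('d) (real (k n)) \<noteq> 0" for n using root_k_pos[of n] c_pos[of n i] by simp
  ultimately show ?thesis by simp
qed

lemma trim_ratio: "(\<lambda>n. real (card (J n) - card (J' n)) / real (card (J n))) \<longlonglongrightarrow> 0"
proof -
  have le: "card (J' n) \<le> card (J n)" for n
    by (intro card_mono finite_trimmed_box trimmed_box_mono) (simp add: g_def)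
  have "eventually (\<lambda>n. 1 - (\<Prod>i\<in>UNIV. max 0 (1 - 2 * (real_of_int (g n $ i) / of_int (t n $ i))))
      = real (card (J n) - card (J' n)) / real (card (J n))) sequentially"
    using t_pos_eventually
  proof eventually_elim
    case (elim n)
    then have t: "0 < real_of_int (t n $ i)" for i by simp
    \<comment> \<open>The \<open>max 0\<close> reflects the truncation by \<open>nat\<close> when
      trimming leaves nothing.\<close>
    have "real (nat (t n $ i - 2 * g n $ i)) / of_int (t n $ i) = max 0 (1 - 2 * (real_of_int (g n $ i) / of_int (t n $ i)))" for i
      using t[of i] by (auto simp: max_def field_simps of_nat_nat)
    then have "real (card (J' n)) / real (card (J n)) = (\<Prod>i\<in>UNIV. max 0 (1 - 2 * (real_of_int (g n $ i) / of_int (t n $ i))))"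
      unfolding card_J by (simp add: card_trimmed_box flip: prod_dividef)
    moreover have "0 < real (card (J n))" unfolding card_J using t by (intro prod_pos) auto
    ultimately show ?case using le[of n] by (simp add: of_nat_diff diff_divide_distrib)
  qed
  moreover have "(\<lambda>n. 1 - (\<Prod>i\<in>(UNIV::'d set). max 0 (1 - 2 * (real_of_int (g n $ i) / of_int (t n $ i)))))
      \<longlonglongrightarrow> 1 - (\<Prod>i\<in>(UNIV::'d set). max 0 (1 - 2 * 0))"
    by (intro tendsto_intros g_ratio)
  then have "(\<lambda>n. 1 - (\<Prod>i\<in>(UNIV::'d set). max 0 (1 - 2 * (real_of_int (g n $ i) / of_int (t n $ i))))) \<longlonglongrightarrow> 0"
    by simp
  ultimately show ?thesis
    by (rule Lim_transform_eventually[rotated])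
qed

section \<open>Exceedance probabilities of sites, shells and boxes\<close>

abbreviation K :: "nat \<Rightarrow> (int ^ 'd) set" where
  "K n \<equiv> K_set \<kappa> (c n)"

lemma mixing: "mixing_bound (x n) (K n) (\<gamma> n) (\<alpha> n)"
  using D unfolding condition_D_def mixing_bound_def prob_field_max_le by blast

text \<open>Two empty sets are separated and turn the mixing bound into 0 <=
  \<open>\<alpha> n\<close>; the interval from 1 to 0 shows that the empty set counts as a
  box.\<close>

lemma \<alpha>_nonneg: "0 \<le> \<alpha> n"
proof -
  have "is_box ({} :: (int ^ 'd) set)"
    unfolding is_box_def by (intro exI[of _ 1] exI[of _ 0]) (auto simp: less_eq_vec_def intro: order_trans)
  moreover have "separated (\<gamma> n) {} {}" by (simp add: separated_def)
  ultimately have "\<bar>prob (below (x n) ({} \<union> {})) - prob (below (x n) {}) * prob (below (x n) {})\<bar> \<le> \<alpha> n"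
    using mixing[of n] unfolding mixing_bound_def by blast
  then show ?thesis by (simp add: prob_space)
qed

lemma \<pi>_eq: "\<pi> n = \<P>(\<omega> in M. \<xi> 0 \<omega> > x n)"
  unfolding \<pi>_def by (rule arg_cong[where f = prob]) (auto simp: below_def)

lemma C_compact: "compact C"
  using C by (rule p_convex_compact)

lemma integral_one_C: "(LINT y:C|lborel. 1) = (1 :: real)"
  using vol_C compact_imp_closed[OF C_compact]
  by (simp add: set_lebesgue_integral_def measure_def)

text \<open>The Riemann sum of the constant 1 with mesh 1 / c shows that the number of lattice
  points of c C is asymptotic to the product of the coordinates of c, as C has volume one. Dividing
  the intensity hypothesis by this ratio gives the claim.\<close>

lemma prod_c_\<pi>: "(\<lambda>n. (\<Prod>i\<in>UNIV. c n $ i) * \<pi> n) \<longlonglongrightarrow> \<tau>"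
proof -
  define w :: "nat \<Rightarrow> real ^ 'd" where "w n = (\<chi> i. 1 / c n $ i)" for n
  have w_pos: "0 < w n $ i" for n i using c_pos by (simp add: w_def)
  have w_lim: "w \<longlonglongrightarrow> 0"
  proof (rule vec_tendstoI)
    fix i
    have "(\<lambda>n. 1 / c n $ i) \<longlonglongrightarrow> 0"
      by (intro tendsto_divide_0[OF tendsto_const] filterlim_at_top_imp_at_infinity c_lim)
    then show "(\<lambda>n. w n $ i) \<longlonglongrightarrow> 0 $ i" by (simp add: w_def)
  qed
  have points: "lattice_points ((*) (c n) ` C) = {z. of_lattice z * w n \<in> C}" for n
  proof -
    have cw: "c n * w n = 1" using c_pos[of n] by (simp add: vec_eq_iff w_def less_imp_neq[THEN not_sym])
    have "u \<in> (*) (c n) ` C \<longleftrightarrow> u * w n \<in> C" for u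
    proof
      assume "u \<in> (*) (c n) ` C"
      then obtain y where "y \<in> C" "u = c n * y" by blast
      then show "u * w n \<in> C" using cw by (simp add: mult.commute mult.left_commute flip: mult.assoc)
    next
      assume "u * w n \<in> C"
      moreover have "u = c n * (u * w n)" using cw by (metis mult.left_commute mult.right_neutral)
      ultimately show "u \<in> (*) (c n) ` C" by blast
    qed
    then show ?thesis by (simp add: lattice_points_def)
  qed
  define d where "d n = real (card (lattice_points ((*) (c n) ` C)))" for n
  have "(\<lambda>n. (\<Sum>z | of_lattice z * w n \<in> C. 1) * (\<Prod>i\<in>UNIV. w n $ i)) \<longlonglongrightarrow> (LINT y:C|lborel. 1 :: real)"
    by (rule riemann_sum_lattice[OF w_pos w_lim C_compact p_convex_negligible_frontier[OF C]]) simp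
  then have dw: "(\<lambda>n. d n * (\<Prod>i\<in>UNIV. w n $ i)) \<longlonglongrightarrow> 1"
    by (simp add: integral_one_C d_def points)
  have "(\<lambda>n. (d n * \<pi> n) / (d n * (\<Prod>i\<in>UNIV. w n $ i))) \<longlonglongrightarrow> \<tau> / 1"
    using intensity dw by (intro tendsto_divide) (simp_all add: d_def \<pi>_eq)
  moreover have "eventually (\<lambda>n. (d n * \<pi> n) / (d n * (\<Prod>i\<in>UNIV. w n $ i)) = (\<Prod>i\<in>UNIV. c n $ i) * \<pi> n) sequentially"
  proof -
    have "eventually (\<lambda>n. d n * (\<Prod>i\<in>UNIV. w n $ i) \<noteq> 0) sequentially"
      by (rule tendsto_imp_eventually_ne[OF dw]) simp
    then show ?thesis
    proof eventually_elim
      case (elim n)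
      have "(\<Prod>i\<in>UNIV. c n $ i) * (\<Prod>i\<in>UNIV. w n $ i) = 1"
        using c_pos[of n] by (simp add: w_def less_imp_neq[THEN not_sym] flip: prod.distrib)
      then show ?case using elim by (simp add: field_simps)
    qed
  qed
  ultimately show ?thesis by (simp add: Lim_transform_eventually)
qed

lemma k_J_\<pi>: "(\<lambda>n. real (k n) * real (card (J n)) * \<pi> n) \<longlonglongrightarrow> \<tau>"
proof -
  have "real (card (J n)) = (\<Prod>i\<in>UNIV. s n $ i) * (\<Prod>i\<in>UNIV. c n $ i)" for n
    unfolding card_J s_eq using c_pos[of n] by (simp add: less_imp_neq[THEN not_sym] flip: prod.distrib)
  then have "(\<lambda>n. real (k n) * real (card (J n)) * \<pi> n)
      = (\<lambda>n. (real (k n) * (\<Prod>i\<in>UNIV. s n $ i)) * ((\<Prod>i\<in>UNIV. c n $ i) * \<pi> n))"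
    by (simp add: fun_eq_iff mult_ac)
  then show ?thesis using tendsto_mult[OF k_prod_s prod_c_\<pi>] by simp
qed

lemma k_trim_\<pi>: "(\<lambda>n. real (k n) * (real (card (J n) - card (J' n)) * \<pi> n)) \<longlonglongrightarrow> 0"
proof -
  have "(\<lambda>n. (real (k n) * real (card (J n)) * \<pi> n) * (real (card (J n) - card (J' n)) / real (card (J n)))) \<longlonglongrightarrow> \<tau> * 0"
    by (intro tendsto_mult k_J_\<pi> trim_ratio)
  moreover have "(real (k n) * real (card (J n)) * \<pi> n) * (real (card (J n) - card (J' n)) / real (card (J n)))
      = real (k n) * (real (card (J n) - card (J' n)) * \<pi> n)" for n
    by (cases "card (J n) = 0") simp_all
  ultimately show ?thesis by simp
qed

text \<open>The rate per site of last points of clusters: the numerator of the conditional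
  probability in condition D^l.\<close>

definition end_prob :: "nat \<Rightarrow> real" where
  "end_prob n = prob (below (x n) (later_neighbours r (t n)) - below (x n) {0})"

lemma k_J_end_prob: "(\<lambda>n. real (k n) * (real (card (J n)) * end_prob n)) \<longlonglongrightarrow> \<theta> * \<tau>"
proof -
  define q where "q n = \<P>(\<omega> in M. field_max \<xi> (A_set r (c n) (k n) 0) \<omega> \<le> x n \<bar> \<xi> 0 \<omega> > x n)" for n
  have "end_prob n = q n * \<pi> n" for n
  proof -
    have "{\<omega> \<in> space M. field_max \<xi> (later_neighbours r (t n)) \<omega> \<le> x n \<and> x n < \<xi> 0 \<omega>}
        = below (x n) (later_neighbours r (t n)) - below (x n) {0}"
      by (auto simp: field_max_def below_def SUP_le_iff)
    then have "q n = end_prob n / \<pi> n"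
      unfolding q_def A_set_eq_later_neighbours[OF box_side_t t_nonneg] cond_prob_def
      by (simp add: end_prob_def \<pi>_eq)
    moreover have "end_prob n \<le> \<pi> n" "0 \<le> end_prob n"
      unfolding end_prob_def \<pi>_def by (auto intro!: finite_measure_mono simp: below_def)
    \<comment> \<open>If exceedances have probability 0, the conditional probability is 0 by the
      division convention and \<open>end_prob n\<close> is squeezed to 0.\<close>
    ultimately show ?thesis by (cases "\<pi> n = 0") auto
  qed
  then have "(\<lambda>n. real (k n) * (real (card (J n)) * end_prob n)) = (\<lambda>n. q n * (real (k n) * real (card (J n)) * \<pi> n))"
    by (simp add: fun_eq_iff)
  moreover have "q \<longlonglongrightarrow> \<theta>" using Dl unfolding q_def condition_Dl_def .
  ultimately show ?thesis using tendsto_mult[OF _ k_J_\<pi>] by simp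
qed

definition enlarged_box :: "nat \<Rightarrow> (int ^ 'd) set" where
  "enlarged_box n = {v. \<forall>i. v $ i \<in> {- t n $ i..<2 * t n $ i}}"

lemma finite_enlarged_box: "finite (enlarged_box n)"
  unfolding enlarged_box_def by (rule finite_vec_Pi) simp

lemma card_enlarged_box: "real (card (enlarged_box n)) = 3 ^ CARD('d) * real (card (J n))"
proof -
  have "card (enlarged_box n) = (\<Prod>i\<in>(UNIV::'d set). 3 * nat (t n $ i))"
    unfolding enlarged_box_def by (subst card_vec_Pi) (auto intro!: prod.cong simp: nat_mult_distrib)
  then show ?thesis by (simp add: prod.distrib card_trimmed_box)
qed

lemma J_subset_enlarged_box: "J n \<subseteq> enlarged_box n"
  by (auto simp: enlarged_box_def trimmed_box_def) (smt (verit) t_nonneg)+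

text \<open>This block sits at the origin, which C need not contain, so the inclusion of
  \<open>D_plus\<close> in K does not supply it. Its sites satisfy |v| <= 2 t <= 2 c / k^(1/d)
  coordinate-wise, which is at most \<kappa> c once k^(1/d) >= 2 / \<kappa>.\<close>

lemma enlarged_box_subset_K_eventually: "eventually (\<lambda>n. enlarged_box n \<subseteq> K n) sequentially"
proof -
  have "eventually (\<lambda>n. 2 / \<kappa> \<le> root CARD('d) (real (k n))) sequentially"
    using root_k_lim by (simp add: filterlim_at_top)
  then show ?thesis
  proof eventually_elim
    case (elim n)
    show ?case
    proof
      fix v assume v: "v \<in> enlarged_box n"
      define y :: "real ^ 'd" where "y = (\<chi> i. of_int (v $ i) / c n $ i)"
      have "\<bar>y $ i\<bar> \<le> \<kappa>" for i
      proof -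
        have "\<bar>v $ i\<bar> \<le> 2 * t n $ i"
          using v t_nonneg[of n i] by (auto simp: enlarged_box_def elim!: allE[of _ i])
        then have "\<bar>real_of_int (v $ i)\<bar> \<le> 2 * real_of_int (t n $ i)"
          by linarith
        also have "\<dots> \<le> 2 * (c n $ i / root CARD('d) (real (k n)))"
          unfolding t_def by (intro mult_left_mono) simp_all
        also have "\<dots> \<le> \<kappa> * c n $ i"
        proof -
          have "2 \<le> root CARD('d) (real (k n)) * \<kappa>"
            using elim \<kappa>_pos by (simp add: pos_divide_le_eq)
          then have "2 / root CARD('d) (real (k n)) \<le> \<kappa>"
            using root_k_pos[of n] by (simp add: pos_divide_le_eq mult.commute)
          then show ?thesis using c_pos[of n i] by (simp add: mult_right_mono flip: times_divide_eq_left)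
        qed
        finally show ?thesis using c_pos[of n i] by (simp add: y_def pos_divide_le_eq)
      qed
      then have "y \<in> cbox (\<chi> i. - \<kappa>) (\<chi> i. \<kappa>)"
        by (simp add: mem_box_cart abs_le_iff minus_le_iff)
      moreover have "of_lattice v = c n * y"
        using c_pos[of n] by (simp add: vec_eq_iff y_def of_lattice_def less_imp_neq[THEN not_sym])
      ultimately show "v \<in> K n"
        unfolding K_set_def lattice_points_def by blast
    qed
  qed
qed

lemma k_exceed_J: "(\<lambda>n. real (k n) * prob (space M - below (x n) (J n))) \<longlonglongrightarrow> \<theta> * \<tau>"
proof (rule tendsto_sandwich[OF _ _ k_J_end_prob])
  let ?two = "\<lambda>n. real (card (J n) - card (J' n)) * \<pi> n + (real (card (J n)) * \<pi> n) * (real (card (enlarged_box n)) * \<pi> n) + \<alpha> n"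
  show "eventually (\<lambda>n. real (k n) * (real (card (J n)) * end_prob n) \<le> real (k n) * prob (space M - below (x n) (J n))) sequentially"
    using t_pos_eventually
    by eventually_elim (auto simp: end_prob_def intro!: mult_left_mono prob_exceed_box_bounds(1)[OF r])
  show "eventually (\<lambda>n. real (k n) * prob (space M - below (x n) (J n)) \<le> real (k n) * (real (card (J n)) * end_prob n + ?two n)) sequentially"
    using t_pos_eventually enlarged_box_subset_K_eventually
  proof eventually_elim
    case (elim n)
    have "prob (space M - below (x n) (J n))
        \<le> real (card (J n)) * end_prob n + prob ((space M - below (x n) (J n)) - below (x n) (enlarged_box n - J n))"
      unfolding end_prob_def enlarged_box_def using elim by (intro prob_exceed_box_bounds(2)[OF r]) simp
    also have "prob ((space M - below (x n) (J n)) - below (x n) (enlarged_box n - J n)) \<le> ?two n"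
      unfolding \<pi>_def using elim
      by (intro prob_two_exceedances_le[OF mixing \<gamma>_le_g] finite_enlarged_box J_subset_enlarged_box) simp_all
    finally show ?case by (intro mult_left_mono) simp_all
  qed
  \<comment> \<open>After multiplication by k, the product term is 3^d (k |J| pi)^2 / k; the square
    converges to tau^2, so the term vanishes like 1 / k.\<close>
  have "(\<lambda>n. real (k n) * (real (card (J n)) * end_prob n) + real (k n) * (real (card (J n) - card (J' n)) * \<pi> n)
      + (real (k n) * real (card (J n)) * \<pi> n) * (3 ^ CARD('d) * (real (k n) * real (card (J n)) * \<pi> n)) * (1 / real (k n))
      + real (k n) * \<alpha> n) \<longlonglongrightarrow> \<theta> * \<tau> + 0 + \<tau> * (3 ^ CARD('d) * \<tau>) * 0 + 0"
    by (intro tendsto_add tendsto_mult k_J_end_prob k_trim_\<pi> k_J_\<pi> k_\<alpha> tendsto_const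
        tendsto_divide_0[OF tendsto_const] filterlim_at_top_imp_at_infinity k_real_lim)
  moreover have "real (k n) * (real (card (J n)) * end_prob n + ?two n) =
      real (k n) * (real (card (J n)) * end_prob n) + real (k n) * (real (card (J n) - card (J' n)) * \<pi> n)
      + (real (k n) * real (card (J n)) * \<pi> n) * (3 ^ CARD('d) * (real (k n) * real (card (J n)) * \<pi> n)) * (1 / real (k n))
      + real (k n) * \<alpha> n" for n
    using k_pos[of n] by (simp add: card_enlarged_box distrib_left mult_ac)
  ultimately show "(\<lambda>n. real (k n) * (real (card (J n)) * end_prob n + ?two n)) \<longlonglongrightarrow> \<theta> * \<tau>"
    by simp
qed

lemma g_nonneg: "0 \<le> g n $ i"
  by (simp add: g_def)

lemma k_exceed_J': "(\<lambda>n. real (k n) * prob (space M - below (x n) (J' n))) \<longlonglongrightarrow> \<theta> * \<tau>"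
proof (rule tendsto_sandwich[OF _ _ _ k_exceed_J])
  have bounds: "prob (space M - below (x n) (J n)) - real (card (J n) - card (J' n)) * \<pi> n \<le> prob (space M - below (x n) (J' n))"
    "prob (space M - below (x n) (J' n)) \<le> prob (space M - below (x n) (J n))" for n
  proof -
    have "below (x n) (J n) \<subseteq> below (x n) (J' n)"
      by (intro below_mono trimmed_box_mono g_nonneg)
    then show "prob (space M - below (x n) (J' n)) \<le> prob (space M - below (x n) (J n))"
      by (intro finite_measure_mono) auto
    have "prob (space M - below (x n) (J n)) \<le> prob ((space M - below (x n) (J' n)) \<union> (below (x n) (J' n) - below (x n) (J n)))"
      by (intro finite_measure_mono) auto
    also have "\<dots> \<le> prob (space M - below (x n) (J' n)) + prob (below (x n) (J' n) - below (x n) (J n))"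
      by (intro measure_Un_le) auto
    also have "prob (below (x n) (J' n) - below (x n) (J n)) \<le> real (card (J n) - card (J' n)) * \<pi> n"
      unfolding \<pi>_def by (rule prob_exceed_trim_le) (rule g_nonneg)
    finally show "prob (space M - below (x n) (J n)) - real (card (J n) - card (J' n)) * \<pi> n \<le> prob (space M - below (x n) (J' n))"
      by simp
  qed
  show "eventually (\<lambda>n. real (k n) * prob (space M - below (x n) (J n)) - real (k n) * (real (card (J n) - card (J' n)) * \<pi> n)
      \<le> real (k n) * prob (space M - below (x n) (J' n))) sequentially"
    unfolding right_diff_distrib[symmetric] by (intro always_eventually allI mult_left_mono bounds) simp
  show "eventually (\<lambda>n. real (k n) * prob (space M - below (x n) (J' n)) \<le> real (k n) * prob (space M - below (x n) (J n))) sequentially"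
    by (intro always_eventually allI mult_left_mono bounds) simp
  show "(\<lambda>n. real (k n) * prob (space M - below (x n) (J n)) - real (k n) * (real (card (J n) - card (J' n)) * \<pi> n)) \<longlonglongrightarrow> \<theta> * \<tau>"
    using tendsto_diff[OF k_exceed_J k_trim_\<pi>] by simp
qed

section \<open>The boxes that carry atoms and the Laplace functional of the cluster process\<close>

abbreviation Z :: "nat \<Rightarrow> (int ^ 'd) set" where
  "Z n \<equiv> {z. of_lattice z * s n \<in> C}"

lemma finite_Z_eventually: "eventually (\<lambda>n. finite (Z n)) sequentially"
  using s_pos_eventually
  by eventually_elim (intro finite_scaled_lattice_points compact_imp_bounded C_compact, simp)

text \<open>The corner of such a box lies in c C, so the box is one of those collected in
  \<open>D_plus\<close>.\<close>

lemma boxes_subset_K: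
  assumes t: "\<And>i. 0 < t n $ i" and z: "z \<in> Z n"
  shows "trimmed_box (t n) 0 z \<subseteq> K n"
proof -
  have corner: "c n * (of_lattice z * s n) = of_lattice (t n) * of_lattice z"
    using c_pos[of n] by (simp add: vec_eq_iff s_eq of_lattice_def less_imp_neq[THEN not_sym])
  have "c n * (of_lattice z * s n) \<in> I_box (c n) (k n) z"
    unfolding in_I_box_iff[OF box_side_t t] corner using t by (simp add: of_lattice_def)
  then have "I_box (c n) (k n) z \<inter> (*) (c n) ` C \<noteq> {}"
    using z by blast
  then have "J_box (c n) (k n) z \<subseteq> D_plus (c n) (k n) C"
    unfolding D_plus_def by blast
  then show ?thesis
    using D_plus_sub[of n] J_box_eq_trimmed_box[OF box_side_t t] by simp
qed

text \<open>The number of boxes is asymptotic to \<open>k n\<close>, as \<open>C\<close> has volume one.\<close>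

lemma riemann_sum_boxes:
  fixes h :: "real ^ 'd \<Rightarrow> real"
  assumes h: "continuous_on C h" and a: "(\<lambda>n. real (k n) * a n) \<longlonglongrightarrow> b"
  shows "(\<lambda>n. (\<Sum>z\<in>Z n. h (of_lattice z * s n)) * a n) \<longlonglongrightarrow> (LINT y:C|lborel. h y) * b"
proof -
  define S where "S n = (\<Sum>z\<in>Z n. h (of_lattice z * s n))" for n
  define q where "q n = (\<Prod>i\<in>UNIV. s n $ i)" for n
  \<comment> \<open>The Riemann sum \<open>S n * q n\<close> carries the cell volume
    \<open>q n\<close>, whereas k times \<open>a n\<close> is known to converge; the two scalings
    are reconciled by k q tending to 1.\<close>
  have "(\<lambda>n. (S n * q n) * (real (k n) * a n) / (real (k n) * q n)) \<longlonglongrightarrow> (LINT y:C|lborel. h y) * b / 1"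
    unfolding S_def q_def
    by (intro tendsto_divide tendsto_mult k_prod_s a
        riemann_sum_lattice_eventually[OF s_pos_eventually s_lim C_compact p_convex_negligible_frontier[OF C] h]) simp
  moreover have "eventually (\<lambda>n. (S n * q n) * (real (k n) * a n) / (real (k n) * q n) = S n * a n) sequentially"
  proof -
    have "eventually (\<lambda>n. real (k n) * q n \<noteq> 0) sequentially"
      unfolding q_def by (rule tendsto_imp_eventually_ne[OF k_prod_s]) simp
    then show ?thesis by eventually_elim simp
  qed
  ultimately have "(\<lambda>n. S n * a n) \<longlonglongrightarrow> (LINT y:C|lborel. h y) * b / 1"
    by (rule Lim_transform_eventually)
  then show ?thesis by (simp add: S_def)
qed

text \<open>An indicator takes only the values 0 and 1, so exp (- F 1_E) = 1 - (1 - exp (- F)) 1_E.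
  This makes the functional affine in each indicator, as thinning requires.\<close>

lemma exp_integral_cluster_process:
  fixes F :: "real ^ 'd \<Rightarrow> real"
  assumes F: "continuous_on C F" and t: "\<And>i. 0 < t n $ i" and fin: "finite (Z n)" and \<omega>: "\<omega> \<in> space M"
  shows "exp (- (\<integral>y. F y \<partial>(cluster_process \<xi> (x n) (c n) (k n) C \<omega>)))
    = (\<Prod>z\<in>Z n. 1 - (1 - exp (- F (of_lattice z * s n))) * indicator (space M - below (x n) (trimmed_box (t n) 0 z)) \<omega>)"
proof -
  have ind: "of_bool (field_max \<xi> (J_box (c n) (k n) z) \<omega> > ereal (x n))
      = (indicator (space M - below (x n) (trimmed_box (t n) 0 z)) \<omega> :: real)" for z
    using \<omega> field_max_le_iff[OF \<omega>, of "trimmed_box (t n) 0 z" "x n"]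
    by (simp add: J_box_eq_trimmed_box[OF box_side_t t] indicator_def flip: not_le)
  have "(\<integral>y. F y \<partial>(cluster_process \<xi> (x n) (c n) (k n) C \<omega>))
      = (\<Sum>z\<in>Z n. F (of_lattice z * s n) * indicator (space M - below (x n) (trimmed_box (t n) 0 z)) \<omega>)"
    unfolding ind[symmetric]
    by (rule integral_cluster_process[OF fin borel_measurable_continuous_on_restrict[OF F]])
  then have "exp (- (\<integral>y. F y \<partial>(cluster_process \<xi> (x n) (c n) (k n) C \<omega>)))
      = (\<Prod>z\<in>Z n. exp (- (F (of_lattice z * s n) * indicator (space M - below (x n) (trimmed_box (t n) 0 z)) \<omega>)))"
    using exp_sum[OF fin, of "\<lambda>z. - (F (of_lattice z * s n) * indicator (space M - below (x n) (trimmed_box (t n) 0 z)) \<omega>)"]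
    by (simp add: sum_negf)
  also have "\<dots> = (\<Prod>z\<in>Z n. 1 - (1 - exp (- F (of_lattice z * s n))) * indicator (space M - below (x n) (trimmed_box (t n) 0 z)) \<omega>)"
    by (intro prod.cong) (auto simp: indicator_def)
  finally show ?thesis .
qed

lemma laplace_cluster_process:
  fixes F :: "real ^ 'd \<Rightarrow> real"
  assumes F: "continuous_on C F" and nonneg: "\<And>y. y \<in> C \<Longrightarrow> 0 \<le> F y"
  shows "(\<lambda>n. \<integral>\<omega>. exp (- (\<integral>y. F y \<partial>(cluster_process \<xi> (x n) (c n) (k n) C \<omega>))) \<partial>M)
    \<longlonglongrightarrow> exp (- (\<theta> * \<tau> * (LINT y:C|lborel. 1 - exp (- F y))))"
proof -
  define h where "h y = 1 - exp (- F y)" for y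
  have h: "continuous_on C h" unfolding h_def by (intro continuous_intros F)
  have h01: "0 \<le> h (of_lattice z * s n) \<and> h (of_lattice z * s n) \<le> 1" if "z \<in> Z n" for z n
    using that nonneg by (simp add: h_def)
  define p' where "p' n = prob (space M - below (x n) (J' n))" for n
  define e where "e n = \<alpha> n + real (card (J n) - card (J' n)) * \<pi> n" for n
  have p': "(\<lambda>n. real (k n) * p' n) \<longlonglongrightarrow> \<theta> * \<tau>"
    unfolding p'_def by (rule k_exceed_J')
  \<comment> \<open>Convergence of k p' forces p' to vanish, which supplies the uniform smallness of
    the factors in the product limit.\<close>
  have "(\<lambda>n. (real (k n) * p' n) * (1 / real (k n))) \<longlonglongrightarrow> \<theta> * \<tau> * 0"
    by (intro tendsto_mult p' tendsto_divide_0[OF tendsto_const] filterlim_at_top_imp_at_infinity k_real_lim)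
  moreover have "(real (k n) * p' n) * (1 / real (k n)) = p' n" for n
    using k_pos[of n] by simp
  ultimately have p'_0: "p' \<longlonglongrightarrow> 0" by simp
  have "(\<lambda>n. (\<Sum>z\<in>Z n. h (of_lattice z * s n)) * p' n) \<longlonglongrightarrow> (LINT y:C|lborel. h y) * (\<theta> * \<tau>)"
    by (rule riemann_sum_boxes[OF h p'])
  then have "(\<lambda>n. \<Sum>z\<in>Z n. h (of_lattice z * s n) * p' n) \<longlonglongrightarrow> (LINT y:C|lborel. h y) * (\<theta> * \<tau>)"
    by (simp only: sum_distrib_right)
  then have prod: "(\<lambda>n. \<Prod>z\<in>Z n. 1 - h (of_lattice z * s n) * p' n) \<longlonglongrightarrow> exp (- ((LINT y:C|lborel. h y) * (\<theta> * \<tau>)))"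
  proof (rule tendsto_prod_one_minus[rotated 2, OF _ _ p'_0])
    fix n z assume z: "z \<in> Z n"
    have "0 \<le> p' n" "p' n \<le> 1" by (simp_all add: p'_def)
    then show "0 \<le> h (of_lattice z * s n) * p' n \<and> h (of_lattice z * s n) * p' n \<le> 1 \<and> h (of_lattice z * s n) * p' n \<le> p' n"
      using h01[OF z] mult_le_one mult_left_le_one_le by auto
  qed
  have "(\<lambda>n. real (k n) * e n) \<longlonglongrightarrow> 0"
    using tendsto_add[OF k_\<alpha> k_trim_\<pi>] by (simp add: e_def distrib_left)
  \<comment> \<open>With the constant function 1 the Riemann sum counts the boxes, so the error per
    box becomes the total error.\<close>
  then have "(\<lambda>n. (\<Sum>z\<in>Z n. 1) * e n) \<longlonglongrightarrow> (LINT y:C|lborel. 1) * 0"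
    by (rule riemann_sum_boxes[rotated]) simp
  then have err: "(\<lambda>n. real (card (Z n)) * e n) \<longlonglongrightarrow> 0" by simp
  have "(\<lambda>n. (\<integral>\<omega>. exp (- (\<integral>y. F y \<partial>(cluster_process \<xi> (x n) (c n) (k n) C \<omega>))) \<partial>M)
      - (\<Prod>z\<in>Z n. 1 - h (of_lattice z * s n) * p' n)) \<longlonglongrightarrow> 0"
  proof (rule Lim_null_comparison[OF _ err])
    show "eventually (\<lambda>n. norm ((\<integral>\<omega>. exp (- (\<integral>y. F y \<partial>(cluster_process \<xi> (x n) (c n) (k n) C \<omega>))) \<partial>M)
        - (\<Prod>z\<in>Z n. 1 - h (of_lattice z * s n) * p' n)) \<le> real (card (Z n)) * e n) sequentially"
      using t_pos_eventually finite_Z_eventually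
    proof eventually_elim
      case (elim n)
      then have t: "0 < t n $ i" for i by blast
      have "(\<integral>\<omega>. exp (- (\<integral>y. F y \<partial>(cluster_process \<xi> (x n) (c n) (k n) C \<omega>))) \<partial>M)
          = (\<integral>\<omega>. (\<Prod>z\<in>Z n. 1 - h (of_lattice z * s n) * indicator (space M - below (x n) (trimmed_box (t n) 0 z)) \<omega>) \<partial>M)"
        unfolding h_def using elim t
        by (intro Bochner_Integration.integral_cong refl exp_integral_cluster_process[OF F])
      then show ?case
        using laplace_boxes[OF mixing \<gamma>_le_g t \<open>finite (Z n)\<close> boxes_subset_K[OF t] \<alpha>_nonneg h01]
        by (simp add: p'_def e_def \<pi>_def)
    qed
  qed
  from tendsto_add[OF this prod] show ?thesis
    by (simp add: h_def mult.commute)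
qed

end

theorem theorem4p1:
  fixes C :: "(real ^ 'd) set"
    and p :: nat
    and c :: "nat \<Rightarrow> real ^ 'd"
    and \<kappa> :: real
    and M :: "'a measure"
    and \<xi> :: "int ^ 'd \<Rightarrow> 'a \<Rightarrow> real"
    and x :: "nat \<Rightarrow> real"
    and \<gamma> :: "nat \<Rightarrow> real ^ 'd"
    and \<alpha> :: "nat \<Rightarrow> real"
    and k :: "nat \<Rightarrow> nat"
    and r :: "(int ^ 'd) rel"
    and \<theta> \<tau> :: real
    and P :: "'b measure"
    and N :: "'b \<Rightarrow> (real ^ 'd) measure"
  assumes "p_convex p C" and "emeasure lborel C = 1"
    and "\<And>n i. 0 < c n $ i"
    and "\<And>i. filterlim (\<lambda>n. c n $ i) at_top sequentially"
    and "prob_space M" and "stationary_field M \<xi>"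
    and "\<And>n. 0 < k n" and "filterlim k at_top sequentially"
    and "vec_smallo (\<lambda>n. \<chi> i. root CARD('d) (real (k n))) c"
    and "0 < \<kappa>" and "\<And>n. D_plus (c n) (k n) C \<subseteq> K_set \<kappa> (c n)"
    and "condition_D M \<xi> x (\<lambda>n. K_set \<kappa> (c n)) c \<gamma> \<alpha>"
    and "(\<lambda>n. real (k n) * \<alpha> n) \<longlonglongrightarrow> 0"
    and "vec_smallo (\<lambda>n. root CARD('d) (real (k n)) *\<^sub>R \<gamma> n) c"
    and "translation_invariant_order r"
    and "0 < \<theta>" and "\<theta> \<le> 1" and "condition_Dl M \<xi> r c x k \<theta>"
    and "0 < \<tau>"
    and "(\<lambda>n. real (card (lattice_points ((*) (c n) ` C))) * \<P>(\<omega> in M. \<xi> 0 \<omega> > x n)) \<longlonglongrightarrow> \<tau>"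
    and "prob_space P" and "homogeneous_poisson_measure P C (\<theta> * \<tau>) N"
  shows "vd_converges C M (\<lambda>n. cluster_process \<xi> (x n) (c n) (k n) C) P N"
  unfolding vd_converges_def
proof (intro allI impI, elim conjE)
  fix f :: "real ^ 'd \<Rightarrow> real"
  assume f: "continuous_on C f" and f_bounded: "bounded (f ` C)" and "\<forall>y\<in>C. 0 \<le> f y"
  then have f_nonneg: "0 \<le> f y" if "y \<in> C" for y using that by blast
  interpret prob_space M by fact
  interpret clustered_field M \<xi> C p c \<kappa> x \<gamma> \<alpha> k r \<theta> \<tau>
    by unfold_locales (fact assms)+
  have f_meas: "f \<in> borel_measurable (restrict_space borel C)"
    by (rule borel_measurable_continuous_on_restrict[OF f])
  have C_borel: "C \<in> sets borel" "emeasure lborel C < \<infinity>"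
    using compact_imp_closed[OF C_compact] vol_C by auto
  have rm: "random_measure P C N"
    using assms(22) by (simp add: homogeneous_poisson_measure_def)
  obtain B where B: "\<And>y. y \<in> C \<Longrightarrow> f y \<le> B"
    using f_bounded unfolding bounded_iff by (metis abs_le_D1 imageI real_norm_def)
  show "weak_conv_m (\<lambda>n. distr M borel (\<lambda>\<omega>. \<integral>y. f y \<partial>(cluster_process \<xi> (x n) (c n) (k n) C \<omega>)))
      (distr P borel (\<lambda>\<omega>. \<integral>y. f y \<partial>(N \<omega>)))"
  proof (rule weak_conv_laplace)
    show "(\<lambda>\<omega>. \<integral>y. f y \<partial>(cluster_process \<xi> (x n) (c n) (k n) C \<omega>)) \<in> borel_measurable M" for n
      by (intro measurable_integral_random_measure[OF random_measure_cluster_process] f_meas f_nonneg measurable_field)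
    show "(\<lambda>\<omega>. \<integral>y. f y \<partial>(N \<omega>)) \<in> borel_measurable P"
      by (intro measurable_integral_random_measure[OF rm] f_meas f_nonneg)
    show "0 \<le> (\<integral>y. f y \<partial>(cluster_process \<xi> (x n) (c n) (k n) C \<omega>))" for n \<omega>
      using f_nonneg by (intro integral_nonneg_AE AE_I2) simp
    show "0 \<le> (\<integral>y. f y \<partial>(N \<omega>))" if "\<omega> \<in> space P" for \<omega>
    proof -
      have "space (N \<omega>) = C"
        using rm that sets_eq_imp_space_eq[of "N \<omega>"] by (simp add: random_measure_def space_restrict_space)
      then show ?thesis using f_nonneg by (intro integral_nonneg_AE AE_I2) simp
    qed
    \<comment> \<open>The factor m moves inside the integral: both Laplace formulas are applied to
      \<open>m * f\<close>, which is again continuous, nonnegative and bounded on C.\<close>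
    fix m :: nat
    have "(\<integral>\<omega>. exp (- (\<integral>y. real m * f y \<partial>(N \<omega>))) \<partial>P) = exp (- (\<theta> * \<tau> * (LINT y:C|lborel. 1 - exp (- (real m * f y)))))"
      using f_meas f_nonneg B
      by (intro laplace_poisson_measure[OF assms(21,22) C_borel, where B = "real m * B"])
        (auto intro: mult_left_mono)
    moreover have "(\<lambda>n. \<integral>\<omega>. exp (- (\<integral>y. real m * f y \<partial>(cluster_process \<xi> (x n) (c n) (k n) C \<omega>))) \<partial>M)
        \<longlonglongrightarrow> exp (- (\<theta> * \<tau> * (LINT y:C|lborel. 1 - exp (- (real m * f y)))))"
      using f_nonneg by (intro laplace_cluster_process continuous_intros f) simp
    ultimately show "(\<lambda>n. \<integral>\<omega>. exp (- (real m * (\<integral>y. f y \<partial>(cluster_process \<xi> (x n) (c n) (k n) C \<omega>)))) \<partial>M)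
        \<longlonglongrightarrow> (\<integral>\<omega>. exp (- (real m * (\<integral>y. f y \<partial>(N \<omega>)))) \<partial>P)"
      by simp
  qed (fact assms)+
qed

end
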